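(* Let $d\geq2$ be an integer. For any positive integer $D$ and any $\delta>0$ there exists a positive integer $k_0=k_0(D,\delta)$ (depending also on $d$) such that for every $E\subset\mathbb{Z}^d$ with $d^*(E)\geq\delta$, there exists an integer $1\leq k\leq k_0$ such that for any $v_1,\ldots,v_d\in\mathbb{Z}^d$ with $$0<|\det(v_1,\ldots,v_d)|\leq D,$$ there exist some $v_0\in E$ and $\gamma\in\mathrm{SL}_d(\mathbb{Z})$ with $$v_0+k\gamma v_i\in E\qquad\text{for all } i=1,\ldots,d .$$
   Context: The upper Banach density of $E\subset\mathbb{Z}^d$ is $$d^*(E)=\limsup_{N\to\infty}\ \sup_{v\in\mathbb{Z}^d}\frac{|E\cap(v+[0,N-1]^d)|}{N^d}.$$ $\det(v_1,\ldots,v_d)$ is the determinant of the $d\times d$ matrix with columns $v_1,\ldots,v_d$. *)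

theory Defs
  imports "HOL-Analysis.Analysis"
begin

(* Z^d is the type int ^ 'd with d = CARD('d); coordinates and d-tuples of vectors are both
   indexed by 'd, so no ordering of the index set is needed for determinants. *)

definition int_box :: "nat \<Rightarrow> (int ^ 'd) set" where
  "int_box N = {x. \<forall>i. 0 \<le> x $ i \<and> x $ i \<le> int N - 1}"

(* The value is an ereal because limsup and SUP are taken in a complete lattice. The junk term at
   N = 0 does not affect the limsup. *)
definition upper_banach_density :: "(int ^ 'd) set \<Rightarrow> ereal" where
  "upper_banach_density E =
     limsup (\<lambda>N. SUP v. ereal (real (card (E \<inter> (+) v ` int_box N)) / real N ^ CARD('d)))"

definition matrix_of_columns :: "('d \<Rightarrow> 'a ^ 'd) \<Rightarrow> 'a ^ 'd ^ 'd" where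
  "matrix_of_columns v = (\<chi> i j. v j $ i)"

definition SL_int :: "(int ^ 'd ^ 'd) set" where
  "SL_int = {\<gamma>. det \<gamma> = 1}"

end

theory Submission
  imports Defs
begin

text \<open>
  The configuration has a lot of freedom: once \<open>\<gamma>\<close> is chosen, with
  \<open>p = \<gamma> e\<close> the image of a primitive vector \<open>e\<close> proportional to the first column of
  \<open>v\<close>, one may replace \<open>\<gamma>\<close> by \<open>\<gamma>'\<close> in \<open>SL\<^sub>d(\<int>)\<close> such that \<open>\<gamma>' v\<^sub>i = \<gamma> v\<^sub>i + \<Delta> n\<^sub>i p\<close>
  with \<open>\<Delta> = det v\<close>, where \<open>n\<^sub>i\<close> is an arbitrary integer for every other column, while the first
  column keeps its image \<open>a p\<close>
  (\<open>exists_SL_with_prescribed_displacements\<close>, by Cramer's rule). Hence only the direction \<open>p\<close>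
  matters. It is enough to find a point \<open>x\<close> with \<open>x\<close> and \<open>x + a p\<close> in \<open>E\<close> such that the
  \<open>d - 1\<close> progressions \<open>x + \<gamma> v\<^sub>i + M \<int> p\<close> all meet \<open>E\<close>, where \<open>M = D!\<close> is a multiple of \<open>\<Delta>\<close>.
  So \<open>p\<close> should satisfy two requirements: almost every progression of step \<open>M p\<close> meets \<open>E\<close>,
  and \<open>E\<close> has many pairs of points with difference \<open>a p\<close>.

  Both are obtained from mean ergodic arguments. Let \<open>m\<close> be an invariant mean on \<open>\<int>\<^sup>d\<close>,
  let \<open>f = 1\<^sub>E - m(E)\<close>, and for a subgroup \<open>G\<close> let \<open>minsq G f\<close> be the least square norm of an
  average of translates of \<open>f\<close> by elements of \<open>G\<close>; in a Hilbert space this is the square norm of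
  the projection of \<open>f\<close> to the \<open>G\<close>-invariant vectors. If \<open>minsq (M \<int> p) f\<close> is small, almost every
  progression of step \<open>M p\<close> meets \<open>E\<close> (\<open>mean_avoiding_le\<close>). The central estimate is
  \<open>sum_minsq_le\<close>: when \<open>minsq H f\<close> is small, and each sum \<open>G\<^sub>s + G\<^sub>t\<close> with \<open>s \<noteq> t\<close> contains \<open>H\<close>,
  the projections belonging to the \<open>G\<^sub>t\<close> are almost orthogonal, so only few of the numbers
  \<open>minsq G\<^sub>t f\<close> can be large. Applied to
  the lattices obtained from a basis by replacing \<open>b\<^sub>i\<close> by \<open>b\<^sub>i + t b\<^sub>j\<close> and omitting \<open>b\<^sub>j\<close>, it
  passes from a lattice of rank \<open>r\<close> to one of rank \<open>r - 1\<close>, and so from \<open>\<int>\<^sup>d\<close> down to a single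
  good direction \<open>u\<close> and, for some \<open>b\<close>, to many good directions \<open>p\<^sub>l = b + l u\<close>
  (\<open>exists_small_directions\<close>). Averaging over \<open>l\<close>, the goodness of \<open>u\<close> shows that differences
  \<open>a p\<^sub>l\<close> occur in \<open>E\<close> with frequency about \<open>m(E)\<^sup>2\<close> (\<open>exists_return\<close>), so some \<open>p\<^sub>l\<close> meets both
  requirements.

  The descent starts from the assumption that \<open>minsq (M' \<int>\<^sup>d) f\<close> is small for a suitable \<open>M'\<close>.
  This holds, with \<open>m\<close> a limit of averages over boxes on which \<open>E\<close> is dense, unless \<open>E\<close> is
  noticeably denser on large boxes of some coset \<open>y + M' \<int>\<^sup>d\<close>. In the latter case \<open>E\<close> is replaced
  by \<open>{x. y + M' x \<in> E}\<close>, whose density is larger by a fixed amount (\<open>density_increment\<close>). As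
  densities are at most one, this happens a bounded number of times, and the dilation factor
  \<open>k\<close> is the accumulated power of \<open>M'\<close>. It depends on \<open>E\<close> but not on \<open>v\<close>.
\<close>

section \<open>Bounded functions and averages of translates\<close>
definition bounded_fun :: "('a \<Rightarrow> real) \<Rightarrow> bool" where
  "bounded_fun f \<longleftrightarrow> (\<exists>c. \<forall>x. \<bar>f x\<bar> \<le> c)"

lemma bounded_funI: "(\<And>x. \<bar>f x\<bar> \<le> c) \<Longrightarrow> bounded_fun f"
  by (auto simp: bounded_fun_def)

lemma bounded_fun_const [simp, intro]: "bounded_fun (\<lambda>x. c)"
  by (auto simp: bounded_fun_def)

lemma bounded_fun_add [simp, intro]:
  "bounded_fun f \<Longrightarrow> bounded_fun g \<Longrightarrow> bounded_fun (\<lambda>x. f x + g x)"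
  unfolding bounded_fun_def by (metis abs_triangle_ineq add_mono order_trans)

lemma bounded_fun_mult [simp, intro]:
  assumes "bounded_fun f" "bounded_fun g"
  shows "bounded_fun (\<lambda>x. f x * g x)"
proof -
  obtain c d where "\<And>x. \<bar>f x\<bar> \<le> c" "\<And>x. \<bar>g x\<bar> \<le> d"
    using assms by (auto simp: bounded_fun_def)
  then have "\<bar>f x * g x\<bar> \<le> c * d" for x
    by (simp add: abs_mult mult_mono')
  then show ?thesis by (rule bounded_funI)
qed

lemma bounded_fun_diff [simp, intro]:
  assumes "bounded_fun f" "bounded_fun g"
  shows "bounded_fun (\<lambda>x. f x - g x)"
  using bounded_fun_add[OF assms(1) bounded_fun_mult[OF bounded_fun_const[of "-1"] assms(2)]] by simp

lemma bounded_fun_uminus [simp, intro]: "bounded_fun f \<Longrightarrow> bounded_fun (\<lambda>x. - f x)"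
  by (auto simp: bounded_fun_def)

lemma bounded_fun_shift [simp, intro]: "bounded_fun f \<Longrightarrow> bounded_fun (\<lambda>x. f (x + y))"
  by (auto simp: bounded_fun_def)

lemma bounded_fun_shift_diff [simp, intro]: "bounded_fun f \<Longrightarrow> bounded_fun (\<lambda>x. f (x - y))"
  by (auto simp: bounded_fun_def)

lemma bounded_fun_sum [simp, intro]:
  "(\<And>t. t \<in> T \<Longrightarrow> bounded_fun (f t)) \<Longrightarrow> bounded_fun (\<lambda>x. \<Sum>t\<in>T. f t x)"
  by (induction T rule: infinite_finite_induct) (auto intro!: bounded_fun_add)

lemma bounded_fun_indicator [simp, intro]: "bounded_fun (indicator S)"
  by (rule bounded_funI[of _ 1]) (auto simp: indicator_def)

text \<open>
  Convex combinations of translations are kept as operators rather than as functions, because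
  the orthogonality estimate below applies an average found for \<open>f\<close> to another function and
  uses that averages commute.
\<close>
inductive_set averaging :: "'a::ab_group_add set \<Rightarrow> (('a \<Rightarrow> real) \<Rightarrow> 'a \<Rightarrow> real) set"
  for G where
  shift: "y \<in> G \<Longrightarrow> (\<lambda>f x. f (x + y)) \<in> averaging G"
| convex: "V \<in> averaging G \<Longrightarrow> W \<in> averaging G \<Longrightarrow> 0 \<le> u \<Longrightarrow> u \<le> 1 \<Longrightarrow>
    (\<lambda>f x. u * V f x + (1 - u) * W f x) \<in> averaging G"

lemma averaging_mono: "W \<in> averaging G \<Longrightarrow> G \<subseteq> H \<Longrightarrow> W \<in> averaging H"
  by (induction rule: averaging.induct) (auto intro: averaging.intros)

lemma convex_le:
  fixes u :: real
  assumes "a \<le> c" "b \<le> c" "0 \<le> u" "u \<le> 1"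
  shows "u * a + (1 - u) * b \<le> c"
  using convex_bound_le[of a c b u "1 - u"] assms by simp

lemma convex_abs_le:
  fixes u :: real
  assumes "\<bar>a\<bar> \<le> c" "\<bar>b\<bar> \<le> c" "0 \<le> u" "u \<le> 1"
  shows "\<bar>u * a + (1 - u) * b\<bar> \<le> c"
  using convex_le[of a c b u] convex_le[of "-a" c "-b" u] assms by (auto simp: abs_le_iff)

lemma averaging_le: "W \<in> averaging G \<Longrightarrow> (\<And>x. \<bar>f x\<bar> \<le> c) \<Longrightarrow> \<bar>W f x\<bar> \<le> c"
  by (induction arbitrary: x rule: averaging.induct) (auto intro: convex_abs_le)

lemma averaging_bounded: "W \<in> averaging G \<Longrightarrow> bounded_fun f \<Longrightarrow> bounded_fun (W f)"
  unfolding bounded_fun_def by (metis averaging_le)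

lemma averaging_diff_const: "W \<in> averaging G \<Longrightarrow> W (\<lambda>x. f x - c) = (\<lambda>x. W f x - c)"
  by (induction rule: averaging.induct) (auto simp: algebra_simps)

lemma averaging_shift:
  "W \<in> averaging G \<Longrightarrow> W (\<lambda>x. f (x + y)) = (\<lambda>x. W f (x + y))"
  by (induction rule: averaging.induct) (auto simp: algebra_simps fun_eq_iff)

lemma averaging_linear:
  "W \<in> averaging G \<Longrightarrow> W (\<lambda>x. a * f x + b * g x) = (\<lambda>x. a * W f x + b * W g x)"
  by (induction rule: averaging.induct) (auto simp: algebra_simps fun_eq_iff)

lemma averaging_commute:
  assumes "W \<in> averaging G"
  shows "V \<in> averaging H \<Longrightarrow> V (W f) = W (V f)"
  by (induction rule: averaging.induct)
     (simp_all add: averaging_shift[OF assms] averaging_linear[OF assms])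

lemma averaging_compose_shift:
  assumes "\<And>x y. x \<in> G \<Longrightarrow> y \<in> G \<Longrightarrow> x + y \<in> G" "y \<in> G"
  shows "W \<in> averaging G \<Longrightarrow> (\<lambda>f x. W f (x + y)) \<in> averaging G"
proof (induction rule: averaging.induct)
  case (shift z)
  then show ?case
    using averaging.shift[of "y + z" G] assms by (simp add: add.assoc)
qed (auto intro: averaging.intros)

lemma averaging_mean:
  fixes h :: "'j \<Rightarrow> 'b::ab_group_add"
  assumes "finite J" "J \<noteq> {}" "\<And>j. j \<in> J \<Longrightarrow> h j \<in> G"
  shows "(\<lambda>f x. (\<Sum>j\<in>J. f (x + h j)) / real (card J)) \<in> averaging G"
  using assms
proof (induction J rule: finite_ne_induct)
  case (singleton j)
  then show ?case using averaging.shift[of "h j" G] by simp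
next
  case (insert j J)
  let ?u = "1 / real (card (insert j J))"
  have c: "real (card (insert j J)) = 1 + real (card J)" "real (card J) > 0"
    using insert by auto
  have "(\<lambda>f x. ?u * f (x + h j) + (1 - ?u) * ((\<Sum>j\<in>J. f (x + h j)) / real (card J)))
      \<in> averaging G"
    by (rule averaging.convex) (use insert c in \<open>auto intro: averaging.shift\<close>)
  moreover have "?u * f (x + h j) + (1 - ?u) * ((\<Sum>j\<in>J. f (x + h j)) / real (card J))
     = (\<Sum>j\<in>insert j J. f (x + h j)) / real (card (insert j J))" for f :: "'b \<Rightarrow> real" and x
  proof -
    have "1 - ?u = real (card J) / real (card (insert j J))"
      using c by (simp add: field_simps)
    then show ?thesis using insert c by (simp add: add_divide_distrib)
  qed
  ultimately show ?case by simp
qed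

section \<open>Invariant means\<close>
locale invariant_mean =
  fixes m :: "('a::ab_group_add \<Rightarrow> real) \<Rightarrow> real"
  assumes mean_add: "bounded_fun f \<Longrightarrow> bounded_fun g \<Longrightarrow> m (\<lambda>x. f x + g x) = m f + m g"
    and mean_scale: "bounded_fun f \<Longrightarrow> m (\<lambda>x. c * f x) = c * m f"
    and mean_nonneg: "bounded_fun f \<Longrightarrow> (\<And>x. 0 \<le> f x) \<Longrightarrow> 0 \<le> m f"
    and mean_one: "m (\<lambda>x. 1) = 1"
    and mean_shift: "bounded_fun f \<Longrightarrow> m (\<lambda>x. f (x + y)) = m f"
begin

lemma mean_diff: "bounded_fun f \<Longrightarrow> bounded_fun g \<Longrightarrow> m (\<lambda>x. f x - g x) = m f - m g"
  using mean_add[of f "\<lambda>x. - g x"] mean_scale[of g "-1"] by (auto simp: bounded_fun_uminus)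

lemma mean_mono:
  assumes "bounded_fun f" "bounded_fun g" "\<And>x. f x \<le> g x"
  shows "m f \<le> m g"
  using mean_nonneg[of "\<lambda>x. g x - f x"] mean_diff[OF assms(2,1)] assms by auto

lemma mean_const: "m (\<lambda>x. c) = c"
  using mean_scale[of "\<lambda>x. 1" c] mean_one by auto

lemma mean_sum:
  "finite T \<Longrightarrow> (\<And>t. t \<in> T \<Longrightarrow> bounded_fun (f t)) \<Longrightarrow> m (\<lambda>x. \<Sum>t\<in>T. f t x) = (\<Sum>t\<in>T. m (f t))"
proof (induction T rule: finite_induct)
  case empty
  then show ?case using mean_const[of 0] by simp
next
  case (insert t T)
  then show ?case by (simp add: mean_add bounded_fun_sum)
qed

definition ip :: "('a \<Rightarrow> real) \<Rightarrow> ('a \<Rightarrow> real) \<Rightarrow> real" where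
  "ip f g = m (\<lambda>x. f x * g x)"

abbreviation nsq :: "('a \<Rightarrow> real) \<Rightarrow> real" where
  "nsq f \<equiv> ip f f"

lemma ip_commute: "ip f g = ip g f"
  by (simp add: ip_def mult.commute)

lemma nsq_nonneg: "bounded_fun f \<Longrightarrow> 0 \<le> nsq f"
  unfolding ip_def by (rule mean_nonneg) auto

lemma ip_linear:
  assumes "bounded_fun f" "bounded_fun g" "bounded_fun h"
  shows "ip (\<lambda>x. a * f x + b * g x) h = a * ip f h + b * ip g h"
proof -
  have "ip (\<lambda>x. a * f x + b * g x) h = m (\<lambda>x. a * (f x * h x) + b * (g x * h x))"
    by (simp add: ip_def algebra_simps)
  also have "\<dots> = a * ip f h + b * ip g h"
    unfolding ip_def using assms
    by (subst mean_add) (auto simp: mean_scale bounded_fun_mult intro!: bounded_fun_mult)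
  finally show ?thesis .
qed

lemma ip_diff:
  assumes "bounded_fun f" "bounded_fun g" "bounded_fun h"
  shows "ip (\<lambda>x. f x - g x) h = ip f h - ip g h"
  using ip_linear[OF assms, of 1 "-1"] by simp

lemma ip_sum:
  assumes "finite T" "\<And>t. t \<in> T \<Longrightarrow> bounded_fun (f t)" "bounded_fun h"
  shows "ip (\<lambda>x. \<Sum>t\<in>T. f t x) h = (\<Sum>t\<in>T. ip (f t) h)"
  unfolding ip_def sum_distrib_right using assms by (subst mean_sum) auto

lemma ip_shift:
  assumes "bounded_fun f" "bounded_fun g"
  shows "ip (\<lambda>x. f (x + y)) g = ip f (\<lambda>x. g (x - y))"
  using mean_shift[of "\<lambda>x. f x * g (x - y)" y] assms
  by (auto simp: ip_def bounded_fun_mult bounded_fun_shift_diff)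

lemma nsq_shift: "bounded_fun f \<Longrightarrow> nsq (\<lambda>x. f (x + y)) = nsq f"
  using mean_shift[of "\<lambda>x. f x * f x" y] by (auto simp: ip_def)

lemma nsq_combination:
  assumes "bounded_fun f" "bounded_fun g"
  shows "nsq (\<lambda>x. a * f x + b * g x) = a\<^sup>2 * nsq f + 2 * a * b * ip f g + b\<^sup>2 * nsq g"
proof -
  let ?h = "\<lambda>x. a * f x + b * g x"
  have h: "bounded_fun ?h" using assms by simp
  have "nsq ?h = a * ip ?h f + b * ip ?h g"
    using ip_linear[OF assms h, of a b] by (simp add: ip_commute)
  also have "\<dots> = a * (a * nsq f + b * ip g f) + b * (a * ip f g + b * nsq g)"
    using assms by (simp add: ip_linear)
  finally show ?thesis by (simp add: ip_commute[of g f] power2_eq_square algebra_simps)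
qed

lemma ip_le_norms:
  assumes "bounded_fun f" "bounded_fun g"
  shows "\<bar>ip f g\<bar> \<le> sqrt (nsq f) * sqrt (nsq g)"
proof -
  have pos: "0 \<le> nsq f" "0 \<le> nsq g" using assms nsq_nonneg by auto
  have key: "2 * a * b * ip f g \<le> a\<^sup>2 * nsq f + b\<^sup>2 * nsq g" for a b
    using nsq_combination[OF assms, of a "-b"] nsq_nonneg[of "\<lambda>x. a * f x + - b * g x"] assms
    by simp
  have "(ip f g)\<^sup>2 \<le> nsq f * nsq g"
  proof (cases "nsq g = 0")
    case False
    have "2 * nsq g * ip f g * ip f g \<le> (nsq g)\<^sup>2 * nsq f + (ip f g)\<^sup>2 * nsq g" by (rule key)
    then have "nsq g * (ip f g)\<^sup>2 \<le> nsq g * (nsq f * nsq g)"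
      by (simp add: power2_eq_square algebra_simps)
    then show ?thesis using False pos by simp
  next
    case True
    have "ip f g = 0"
    proof (rule ccontr)
      assume n: "ip f g \<noteq> 0"
      have "2 * 1 * ((nsq f + 1) / (2 * ip f g)) * ip f g \<le> 1\<^sup>2 * nsq f"
        using key[of 1 "(nsq f + 1) / (2 * ip f g)"] True by simp
      then show False using n by simp
    qed
    then show ?thesis using True by simp
  qed
  then show ?thesis
    by (metis real_sqrt_abs real_sqrt_le_mono real_sqrt_mult)
qed

lemma ip_le_norm:
  assumes "bounded_fun f" "bounded_fun g" "nsq f \<le> e\<^sup>2" "nsq g \<le> 1" "0 \<le> e"
  shows "\<bar>ip f g\<bar> \<le> e"
proof -
  have "\<bar>ip f g\<bar> \<le> sqrt (nsq f) * sqrt (nsq g)" using assms by (intro ip_le_norms)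
  also have "\<dots> \<le> e * 1"
    using assms by (intro mult_mono) (auto intro: real_le_lsqrt nsq_nonneg)
  finally show ?thesis by simp
qed

lemma nsq_le_one:
  assumes "\<And>x. \<bar>f x\<bar> \<le> 1"
  shows "nsq f \<le> 1"
proof -
  have "f x * f x \<le> 1" for x
    using assms[of x] by (metis abs_le_square_iff abs_one one_power2 power2_eq_square)
  then have "m (\<lambda>x. f x * f x) \<le> m (\<lambda>x. 1)"
    using bounded_funI[of f, OF assms] by (intro mean_mono) auto
  then show ?thesis by (simp add: ip_def mean_one)
qed

lemma nsq_convex:
  assumes "bounded_fun f" "bounded_fun g" "0 \<le> u" "u \<le> 1" "nsq f \<le> c" "nsq g \<le> c"
  shows "nsq (\<lambda>x. u * f x + (1 - u) * g x) \<le> c"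
proof -
  have "0 \<le> nsq (\<lambda>x. 1 * f x + (-1) * g x)"
    by (rule nsq_nonneg) (use assms in simp)
  then have "2 * ip f g \<le> nsq f + nsq g"
    using nsq_combination[OF assms(1,2), of 1 "-1"] by simp
  then have "u * (1 - u) * (2 * ip f g) \<le> u * (1 - u) * (nsq f + nsq g)"
    using assms by (intro mult_left_mono) auto
  then have "nsq (\<lambda>x. u * f x + (1 - u) * g x) \<le> u * nsq f + (1 - u) * nsq g"
    unfolding nsq_combination[OF assms(1,2)] by (simp add: power2_eq_square algebra_simps)
  also have "\<dots> \<le> c" using assms by (intro convex_le)
  finally show ?thesis .
qed

lemma nsq_averaging_le: "W \<in> averaging G \<Longrightarrow> bounded_fun f \<Longrightarrow> nsq (W f) \<le> nsq f"
proof (induction rule: averaging.induct)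
  case (convex V W u)
  then show ?case by (intro nsq_convex) (simp_all add: averaging_bounded)
qed (simp add: nsq_shift)

lemma mean_averaging: "W \<in> averaging G \<Longrightarrow> bounded_fun f \<Longrightarrow> m (W f) = m f"
proof (induction rule: averaging.induct)
  case (convex V W u)
  then have "m (\<lambda>x. u * V f x + (1 - u) * W f x) = u * m (V f) + (1 - u) * m (W f)"
    by (subst mean_add) (simp_all add: mean_scale averaging_bounded)
  then show ?case using convex by (simp add: algebra_simps)
qed (auto simp: mean_shift)

section \<open>Minimal norms of averages\<close>

text \<open>
  By the mean ergodic theorem this would be the square norm of the orthogonal projection of
  \<open>f\<close> to the \<open>G\<close>-invariant functions. The infimum avoids completing the space: a near-minimiser
  serves as the projection.
\<close>
definition minsq :: "'a set \<Rightarrow> ('a \<Rightarrow> real) \<Rightarrow> real" where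
  "minsq G f = (INF W\<in>averaging G. nsq (W f))"

lemma nsq_averaging_nonneg: "W \<in> averaging G \<Longrightarrow> bounded_fun f \<Longrightarrow> 0 \<le> nsq (W f)"
  by (simp add: nsq_nonneg averaging_bounded)

lemma minsq_le: "W \<in> averaging G \<Longrightarrow> bounded_fun f \<Longrightarrow> minsq G f \<le> nsq (W f)"
  unfolding minsq_def
  by (rule cINF_lower[OF bdd_belowI2[of _ 0]]) (simp_all add: nsq_averaging_nonneg[of _ G])

lemma averaging_nonempty: "G \<noteq> {} \<Longrightarrow> averaging G \<noteq> {}"
  by (metis all_not_in_conv averaging.shift)

lemma minsq_greatest:
  "G \<noteq> {} \<Longrightarrow> (\<And>W. W \<in> averaging G \<Longrightarrow> c \<le> nsq (W f)) \<Longrightarrow> c \<le> minsq G f"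
  unfolding minsq_def by (rule cINF_greatest) (auto simp: averaging_nonempty)

lemma minsq_less_obtain:
  assumes "G \<noteq> {}" "minsq G f < c"
  obtains W where "W \<in> averaging G" "nsq (W f) < c"
  using minsq_greatest[OF assms(1), of c f] assms(2) by (meson not_le)

lemma minsq_antimono: "H \<noteq> {} \<Longrightarrow> H \<subseteq> G \<Longrightarrow> bounded_fun f \<Longrightarrow> minsq G f \<le> minsq H f"
  by (rule minsq_greatest, assumption, rule minsq_le[OF averaging_mono])

text \<open>
  The midpoint of a near-minimal average and its translate is again an average, so its norm is
  not much smaller; the parallelogram identity then forces the two to be close.
\<close>
lemma near_minimal_invariant:
  assumes sum: "\<And>x y. x \<in> G \<Longrightarrow> y \<in> G \<Longrightarrow> x + y \<in> G" and f: "bounded_fun f"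
    and W: "W \<in> averaging G" and near: "nsq (W f) \<le> minsq G f + q\<^sup>2" and y: "y \<in> G"
  shows "nsq (\<lambda>x. W f (x + y) - W f x) \<le> (2 * q)\<^sup>2"
proof -
  let ?g = "W f" and ?h = "\<lambda>x. W f (x + y)"
  have b: "bounded_fun ?g" "bounded_fun ?h" using averaging_bounded[OF W f] by auto
  have n: "nsq ?h = nsq ?g" using b by (simp add: nsq_shift)
  have "(\<lambda>f x. W f (x + y)) \<in> averaging G"
    using averaging_compose_shift[OF sum y W] .
  then have "(\<lambda>f x. (1/2) * W f x + (1 - 1/2) * W f (x + y)) \<in> averaging G"
    by (intro averaging.convex W) auto
  from minsq_le[OF this f] have "minsq G f \<le> nsq (\<lambda>x. (1/2) * ?g x + (1/2) * ?h x)"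
    by simp
  also have "\<dots> = (nsq ?g + ip ?g ?h) / 2"
    using nsq_combination[OF b, of "1/2" "1/2"] n by (simp add: power2_eq_square field_simps)
  finally have "nsq ?g - ip ?g ?h \<le> 2 * q\<^sup>2" using near by simp
  moreover have "nsq (\<lambda>x. ?h x - ?g x) = 2 * (nsq ?g - ip ?g ?h)"
    using nsq_combination[OF b(2,1), of 1 "-1"] n by (simp add: ip_commute[of ?h ?g])
  ultimately show ?thesis by (simp add: power_mult_distrib)
qed

text \<open>
  For an orthogonal projection \<open>P\<close> one has \<open>\<langle>f, P f\<rangle> = \<parallel>P f\<parallel>\<^sup>2\<close>. Here \<open>\<langle>V f, W f\<rangle>\<close> hardly
  changes when \<open>V\<close> runs through the averages over \<open>G\<close>, since a translation applied to \<open>f\<close> can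
  be moved to the almost invariant \<open>W f\<close>; the two sides are \<open>V = id\<close> and \<open>V = W\<close>.
\<close>
lemma near_minimal_ip:
  assumes G: "\<And>x y. x \<in> G \<Longrightarrow> y \<in> G \<Longrightarrow> x + y \<in> G" "\<And>x. x \<in> G \<Longrightarrow> - x \<in> G"
    and f: "bounded_fun f" "nsq f \<le> 1"
    and W: "W \<in> averaging G" and near: "nsq (W f) \<le> minsq G f + q\<^sup>2" and q: "0 \<le> q"
  shows "\<bar>nsq (W f) - ip f (W f)\<bar> \<le> 2 * q"
proof -
  have b: "bounded_fun (W f)" using averaging_bounded[OF W f(1)] .
  have "V \<in> averaging G \<Longrightarrow> \<bar>ip (V f) (W f) - ip f (W f)\<bar> \<le> 2 * q" for V
  proof (induction rule: averaging.induct)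
    case (shift y)
    have "ip (\<lambda>x. f (x + y)) (W f) - ip f (W f) = ip (\<lambda>x. W f (x + - y) - W f x) f"
      using ip_shift[OF f(1) b, of y] ip_diff[OF bounded_fun_shift[OF b, of "- y"] b f(1)]
        ip_commute[of f "W f"] ip_commute[of f "\<lambda>x. W f (x - y)"] by simp
    moreover have "\<bar>ip (\<lambda>x. W f (x + - y) - W f x) f\<bar> \<le> 2 * q"
      using near_minimal_invariant[OF G(1) f(1) W near G(2)[OF shift]] b f q
      by (intro ip_le_norm) simp_all
    ultimately show ?case by simp
  next
    case (convex V V' u)
    have eq: "ip (\<lambda>x. u * V f x + (1 - u) * V' f x) (W f) - ip f (W f)
       = u * (ip (V f) (W f) - ip f (W f)) + (1 - u) * (ip (V' f) (W f) - ip f (W f))"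
      unfolding ip_linear[OF averaging_bounded[OF convex(1) f(1)] averaging_bounded[OF convex(2) f(1)] b]
      by (simp add: algebra_simps)
    show ?case unfolding eq using convex by (intro convex_abs_le)
  qed
  from this[OF W] show ?thesis .
qed

text \<open>
  For commuting projections, \<open>\<langle>P f, P' f\<rangle> = \<parallel>P P' f\<parallel>\<^sup>2\<close>, and \<open>P P'\<close> is the projection for
  \<open>G + G'\<close>. The approximate version: shifting \<open>W f\<close> by \<open>x + y\<close> hardly changes its inner product
  with \<open>W' f\<close>, as the part \<open>x \<in> G\<close> is absorbed by \<open>W f\<close> and the part \<open>y \<in> G'\<close> by \<open>W' f\<close>.
  Averaging these shifts with \<open>V\<close> replaces \<open>W f\<close> by \<open>V (W f) = W (V f)\<close>, which is small.
\<close>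
lemma near_minimal_orthogonal:
  assumes G: "\<And>x y. x \<in> G \<Longrightarrow> y \<in> G \<Longrightarrow> x + y \<in> G"
    and G': "\<And>x y. x \<in> G' \<Longrightarrow> y \<in> G' \<Longrightarrow> x + y \<in> G'" "\<And>x. x \<in> G' \<Longrightarrow> - x \<in> G'"
    and H: "\<And>z. z \<in> H \<Longrightarrow> \<exists>x\<in>G. \<exists>y\<in>G'. z = x + y"
    and f: "bounded_fun f" "nsq f \<le> 1" and q: "0 \<le> q"
    and W: "W \<in> averaging G" "nsq (W f) \<le> minsq G f + q\<^sup>2"
    and W': "W' \<in> averaging G'" "nsq (W' f) \<le> minsq G' f + q\<^sup>2"
    and V: "V \<in> averaging H" "nsq (V f) \<le> e\<^sup>2" "0 \<le> e"
  shows "\<bar>ip (W f) (W' f)\<bar> \<le> 4 * q + e"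
proof -
  let ?g = "W f" and ?h = "W' f"
  have b: "bounded_fun ?g" "bounded_fun ?h"
    using averaging_bounded[OF W(1) f(1)] averaging_bounded[OF W'(1) f(1)] by auto
  have n: "nsq ?g \<le> 1" "nsq ?h \<le> 1" 
    using nsq_averaging_le[OF W(1) f(1)] nsq_averaging_le[OF W'(1) f(1)] f(2) by auto
  have "V \<in> averaging H \<Longrightarrow> \<bar>ip (V ?g) ?h - ip ?g ?h\<bar> \<le> 4 * q" for V
  proof (induction rule: averaging.induct)
    case (shift z)
    then obtain x y where xy: "x \<in> G" "y \<in> G'" "z = x + y" using H by blast
    let ?gx = "\<lambda>t. ?g (t + x)" and ?hy = "\<lambda>t. ?h (t + - y)"
    have bb: "bounded_fun ?gx" "bounded_fun ?hy" using b by auto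
    have "ip (\<lambda>t. ?g (t + z)) ?h = ip ?gx ?hy"
      using ip_shift[OF bb(1) b(2), of y] xy by (simp add: add_ac)
    then have "ip (\<lambda>t. ?g (t + z)) ?h - ip ?g ?h
      = ip (\<lambda>t. ?gx t - ?g t) ?hy + ip (\<lambda>t. ?hy t - ?h t) ?g"
      using ip_diff[OF bb(1) b(1) bb(2)] ip_diff[OF bb(2) b(2) b(1)] ip_commute[of ?g ?h]
        ip_commute[of ?g ?hy] by simp
    moreover have "nsq ?hy \<le> 1" using n nsq_shift[OF b(2), of "-y"] by simp
    then have "\<bar>ip (\<lambda>t. ?gx t - ?g t) ?hy\<bar> \<le> 2 * q"
      using near_minimal_invariant[OF G f(1) W xy(1)] b bb q by (intro ip_le_norm) simp_all
    moreover have "\<bar>ip (\<lambda>t. ?hy t - ?h t) ?g\<bar> \<le> 2 * q"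
      using near_minimal_invariant[OF G'(1) f(1) W' G'(2)[OF xy(2)]] b bb q n
      by (intro ip_le_norm) simp_all
    ultimately show ?case by linarith
  next
    case (convex V V' u)
    have eq: "ip (\<lambda>x. u * V ?g x + (1 - u) * V' ?g x) ?h - ip ?g ?h
       = u * (ip (V ?g) ?h - ip ?g ?h) + (1 - u) * (ip (V' ?g) ?h - ip ?g ?h)"
      unfolding ip_linear[OF averaging_bounded[OF convex(1) b(1)] averaging_bounded[OF convex(2) b(1)] b(2)]
      by (simp add: algebra_simps)
    show ?case unfolding eq using convex by (intro convex_abs_le)
  qed
  from this[OF V(1)] have "\<bar>ip (V ?g) ?h - ip ?g ?h\<bar> \<le> 4 * q" .
  moreover have "ip (V ?g) ?h = ip (W (V f)) ?h" using averaging_commute[OF W(1) V(1)] by simp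
  moreover have "nsq (W (V f)) \<le> e\<^sup>2"
    using nsq_averaging_le[OF W(1) averaging_bounded[OF V(1) f(1)]] V(2) by simp
  then have "\<bar>ip (W (V f)) ?h\<bar> \<le> e"
    using b(2) averaging_bounded[OF W(1) averaging_bounded[OF V(1) f(1)]] V(3) n(2)
    by (intro ip_le_norm)
  ultimately show ?thesis by linarith
qed

text \<open>
  Almost orthogonal vectors \<open>g\<^sub>t\<close>, each with \<open>\<langle>g\<^sub>t, f\<rangle> \<approx> \<parallel>g\<^sub>t\<parallel>\<^sup>2\<close>, satisfy a Bessel inequality, here
  in the form obtained by expanding \<open>0 \<le> \<parallel>(\<Sum>t. g\<^sub>t) - f\<parallel>\<^sup>2\<close>. The bound \<open>2\<close> instead of \<open>1\<close> absorbs the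
  errors from working with near-minimisers.
\<close>
lemma sum_minsq_le:
  fixes G :: "'t \<Rightarrow> 'a set"
  assumes T: "finite T" "T \<noteq> {}"
    and G: "\<And>t x y. t \<in> T \<Longrightarrow> x \<in> G t \<Longrightarrow> y \<in> G t \<Longrightarrow> x + y \<in> G t"
       "\<And>t x. t \<in> T \<Longrightarrow> x \<in> G t \<Longrightarrow> - x \<in> G t" "\<And>t. t \<in> T \<Longrightarrow> G t \<noteq> {}"
    and H: "\<And>s t z. s \<in> T \<Longrightarrow> t \<in> T \<Longrightarrow> s \<noteq> t \<Longrightarrow> z \<in> H \<Longrightarrow> \<exists>x\<in>G s. \<exists>y\<in>G t. z = x + y"
      "H \<noteq> {}"
    and f: "bounded_fun f" "nsq f \<le> 1"
    and e: "minsq H f < e\<^sup>2" "0 \<le> e"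
  shows "(\<Sum>t\<in>T. minsq (G t) f) \<le> 2 + (real (card T))\<^sup>2 * e"
proof -
  define R where "R = real (card T)"
  have R: "R \<ge> 1" using T by (simp add: R_def card_gt_0_iff Suc_leI)
  \<comment> \<open>All near-minimality errors add up to at most \<open>8 R\<^sup>2 q\<close>.\<close>
  define q where "q = 1 / (8 * R\<^sup>2)"
  have q: "0 < q" using R by (simp add: q_def)
  obtain V where V: "V \<in> averaging H" "nsq (V f) < e\<^sup>2"
    using minsq_less_obtain[OF H(2) e(1)] .
  have "\<exists>W. \<forall>t\<in>T. W t \<in> averaging (G t) \<and> nsq (W t f) \<le> minsq (G t) f + q\<^sup>2"
  proof (rule bchoice, rule ballI)
    fix t assume t: "t \<in> T"
    have "minsq (G t) f < minsq (G t) f + q\<^sup>2" using q by simp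
    from minsq_less_obtain[OF G(3)[OF t] this]
    show "\<exists>W. W \<in> averaging (G t) \<and> nsq (W f) \<le> minsq (G t) f + q\<^sup>2"
      by (metis less_imp_le)
  qed
  then obtain W where W: "\<And>t. t \<in> T \<Longrightarrow> W t \<in> averaging (G t)"
      "\<And>t. t \<in> T \<Longrightarrow> nsq (W t f) \<le> minsq (G t) f + q\<^sup>2" by blast
  have b: "bounded_fun (W t f)" if "t \<in> T" for t using averaging_bounded[OF W(1)[OF that] f(1)] .
  define s where "s = (\<Sum>t\<in>T. nsq (W t f))"
  let ?F = "\<lambda>x. \<Sum>t\<in>T. W t f x"
  have bF: "bounded_fun ?F" using b by simp
  have near: "nsq (W t f) - 2 * q \<le> ip (W t f) f" if t: "t \<in> T" for t
    using near_minimal_ip[OF G(1)[OF t] G(2)[OF t] f W(1)[OF t] W(2)[OF t]] q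
    by (simp add: ip_commute[of f])
  have "s - R * (2 * q) = (\<Sum>t\<in>T. nsq (W t f) - 2 * q)"
    by (simp add: s_def R_def sum_subtractf)
  also have "\<dots> \<le> (\<Sum>t\<in>T. ip (W t f) f)"
    by (intro sum_mono near)
  also have "\<dots> = ip ?F f" using ip_sum[OF T(1) b f(1)] by simp
  finally have lower: "s - R * (2 * q) \<le> ip ?F f" .
  have "nsq ?F = (\<Sum>t\<in>T. ip (W t f) ?F)" using ip_sum[OF T(1) b bF] by simp
  also have "\<dots> = (\<Sum>t\<in>T. \<Sum>r\<in>T. ip (W r f) (W t f))"
    using ip_sum[OF T(1) b b] by (simp add: ip_commute[of _ ?F])
  also have "\<dots> \<le> (\<Sum>t\<in>T. nsq (W t f) + R * (4 * q + e))"
  proof (rule sum_mono)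
    fix t assume t: "t \<in> T"
    have "(\<Sum>r\<in>T. ip (W r f) (W t f)) = nsq (W t f) + (\<Sum>r\<in>T-{t}. ip (W r f) (W t f))"
      by (rule sum.remove[OF T(1) t])
    also have "(\<Sum>r\<in>T-{t}. ip (W r f) (W t f)) \<le> (\<Sum>r\<in>T-{t}. 4 * q + e)"
    proof (rule sum_mono)
      fix r assume "r \<in> T - {t}"
      then have rt: "r \<in> T" and ne: "r \<noteq> t" by auto
      have "\<bar>ip (W r f) (W t f)\<bar> \<le> 4 * q + e"
        using near_minimal_orthogonal[OF G(1)[OF rt] G(1)[OF t] G(2)[OF t] H(1)[OF rt t ne]
            f less_imp_le[OF q] W(1)[OF rt] W(2)[OF rt] W(1)[OF t] W(2)[OF t]
            V(1) less_imp_le[OF V(2)] e(2)] .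
      then show "ip (W r f) (W t f) \<le> 4 * q + e" by linarith
    qed
    also have "\<dots> \<le> R * (4 * q + e)"
      using t T q e by (auto simp: R_def intro!: mult_right_mono)
    finally show "(\<Sum>r\<in>T. ip (W r f) (W t f)) \<le> nsq (W t f) + R * (4 * q + e)" by simp
  qed
  also have "\<dots> = s + R\<^sup>2 * (4 * q + e)"
    by (simp add: sum.distrib s_def R_def power2_eq_square)
  finally have upper: "nsq ?F \<le> s + R\<^sup>2 * (4 * q + e)" .
  have "0 \<le> nsq (\<lambda>x. 1 * ?F x + (-1) * f x)"
    by (rule nsq_nonneg) (use bF f in simp)
  then have "2 * ip ?F f \<le> nsq ?F + nsq f"
    using nsq_combination[OF bF f(1), of 1 "-1"] by simp
  then have "s \<le> 1 + 4 * (R * q) + R\<^sup>2 * (4 * q + e)"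
    using lower upper f(2) by simp
  moreover have "R\<^sup>2 * q = 1 / 8" using R by (simp add: q_def)
  moreover have "R * q \<le> R\<^sup>2 * q"
    using R q by (intro mult_right_mono self_le_power) auto
  moreover have "R\<^sup>2 * (4 * q + e) = 4 * (R\<^sup>2 * q) + R\<^sup>2 * e" by (simp add: algebra_simps)
  moreover have "(\<Sum>t\<in>T. minsq (G t) f) \<le> s"
    unfolding s_def using W(1) f(1) by (intro sum_mono minsq_le)
  ultimately show ?thesis unfolding R_def[symmetric] by linarith
qed

section \<open>Sets seen through an invariant mean\<close>

text \<open>
  At a point whose \<open>G\<close>-orbit misses \<open>E\<close> every average of the balanced indicator function equals
  \<open>- m(E)\<close>, so a large set of such points makes every average large.
\<close>
lemma mean_avoiding_le:
  fixes E G :: "'a set"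
  defines "f \<equiv> \<lambda>x. indicator E x - m (indicator E)"
  assumes G: "G \<noteq> {}"
  shows "(m (indicator E))\<^sup>2 * m (indicator {x. \<forall>y\<in>G. x + y \<notin> E}) \<le> minsq G f"
proof (rule minsq_greatest[OF G])
  fix W assume W: "W \<in> averaging G"
  let ?B = "{x. \<forall>y\<in>G. x + y \<notin> E}" and ?a = "m (indicator E)"
  have bf: "bounded_fun f" by (simp add: f_def)
  have zero: "W (indicator E) x = 0" if x: "x \<in> ?B" for x
    using W by (induction rule: averaging.induct) (use x in auto)
  have "?a\<^sup>2 * indicator ?B x \<le> W f x * W f x" for x
    using zero[of x] averaging_diff_const[OF W, of "indicator E" ?a]
    by (auto simp: f_def indicator_def power2_eq_square)
  then have "m (\<lambda>x. ?a\<^sup>2 * indicator ?B x) \<le> nsq (W f)"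
    unfolding ip_def using averaging_bounded[OF W bf] by (intro mean_mono) simp_all
  then show "?a\<^sup>2 * m (indicator ?B) \<le> nsq (W f)" by (simp add: mean_scale)
qed

lemma exists_point_avoiding_shifts:
  assumes T: "finite T"
    and less: "real (card T) * m (indicator B) < m (\<lambda>x. indicator E x * indicator E (x + z))"
  shows "\<exists>x. x \<in> E \<and> x + z \<in> E \<and> (\<forall>t\<in>T. x + y t \<notin> B)"
proof (rule ccontr)
  assume no: "\<not> ?thesis"
  have "indicator E x * indicator E (x + z) \<le> (\<Sum>t\<in>T. indicator B (x + y t) :: real)" for x
  proof (cases "x \<in> E \<and> x + z \<in> E")
    case True
    then obtain t where t: "t \<in> T" "x + y t \<in> B" using no by blast
    have "indicator B (x + y t) \<le> (\<Sum>t\<in>T. indicator B (x + y t) :: real)"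
      by (rule member_le_sum[OF t(1) _ T]) simp
    then show ?thesis using t True by simp
  qed (auto simp: indicator_def intro: sum_nonneg)
  then have "m (\<lambda>x. indicator E x * indicator E (x + z)) \<le> m (\<lambda>x. \<Sum>t\<in>T. indicator B (x + y t))"
    by (intro mean_mono) auto
  also have "\<dots> = (\<Sum>t\<in>T. m (\<lambda>x. indicator B (x + y t)))"
    using T by (intro mean_sum) auto
  also have "\<dots> = real (card T) * m (indicator B)" by (simp add: mean_shift)
  finally show False using less by simp
qed

text \<open>
  The index \<open>l\<close> enumerates displacements \<open>z l\<close>, and the group \<open>G\<close> shifts the index. Since \<open>f\<close> has a
  small \<open>G\<close>-average, some weighted average over \<open>l\<close> of the correlations of \<open>E\<close> with its translates by
  \<open>z l\<close> is at least about \<open>m(E)\<^sup>2\<close>. The costs \<open>c l\<close> are controlled on average over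
  every block of \<open>R\<close> consecutive indices; averaging over a block in addition keeps the first
  statement and makes the second one independent of the unknown weights.
\<close>
lemma exists_return:
  fixes E :: "'a set" and z :: "int \<Rightarrow> 'a" and c :: "int \<Rightarrow> real"
  defines "f \<equiv> \<lambda>x. indicator E x - m (indicator E)"
  assumes G: "G \<noteq> {}" "\<And>y. y \<in> G \<Longrightarrow> \<exists>l. \<forall>r. z r + y = z (l + r)"
    and q: "minsq G f < q\<^sup>2" "0 \<le> q"
    and R: "0 < R" "\<And>l. (\<Sum>r\<in>{0..<int R}. c (l + r)) \<le> real R * e"
    and C: "0 \<le> C" "C * e + q < (m (indicator E))\<^sup>2"
  shows "\<exists>l. C * c l < m (\<lambda>x. indicator E x * indicator E (x + z l))"
proof (rule ccontr)
  assume "\<not> ?thesis"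
  then have le: "m (\<lambda>x. indicator E x * indicator E (x + z l)) \<le> C * c l" for l
    by (simp add: not_less)
  define a where "a = m (indicator E)"
  let ?I = "{0..<int R}"
  have bf: "bounded_fun f" by (simp add: f_def)
  have single: "ip (\<lambda>x. f (x + z l)) (indicator E) \<le> C * c l - a\<^sup>2" for l
  proof -
    have "ip (\<lambda>x. f (x + z l)) (indicator E)
        = m (\<lambda>x. indicator E x * indicator E (x + z l) - a * indicator E x)"
      by (simp add: ip_def f_def a_def algebra_simps)
    also have "\<dots> = m (\<lambda>x. indicator E x * indicator E (x + z l)) - a * a"
      by (subst mean_diff) (auto simp: mean_scale a_def)
    finally show ?thesis using le[of l] by (simp add: power2_eq_square)
  qed
  \<comment> \<open>The bound passes to convex combinations, so it suffices to check it for translations.\<close>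
  have upper: "(\<Sum>r\<in>?I. ip (\<lambda>x. W f (x + z r)) (indicator E)) \<le> real R * (C * e - a\<^sup>2)"
    if "W \<in> averaging G" for W
    using that
  proof (induction rule: averaging.induct)
    case (shift y)
    then obtain l where l: "\<And>r. z r + y = z (l + r)" using G(2) by blast
    have "(\<Sum>r\<in>?I. ip (\<lambda>x. f (x + z r + y)) (indicator E))
        \<le> (\<Sum>r\<in>?I. C * c (l + r) - a\<^sup>2)"
      using single by (intro sum_mono) (simp add: add.assoc l)
    also have "\<dots> = C * (\<Sum>r\<in>?I. c (l + r)) - real R * a\<^sup>2"
      by (simp add: sum_subtractf sum_distrib_left)
    also have "\<dots> \<le> C * (real R * e) - real R * a\<^sup>2"
      using R(2)[of l] C(1) by (simp add: mult_left_mono)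
    finally show ?case by (simp add: algebra_simps)
  next
    case (convex V W u)
    have "ip (\<lambda>x. u * V f (x + z r) + (1 - u) * W f (x + z r)) (indicator E)
       = u * ip (\<lambda>x. V f (x + z r)) (indicator E)
         + (1 - u) * ip (\<lambda>x. W f (x + z r)) (indicator E)" for r
      using averaging_bounded[OF convex(1) bf] averaging_bounded[OF convex(2) bf]
      by (intro ip_linear) auto
    then have "(\<Sum>r\<in>?I. ip (\<lambda>x. u * V f (x + z r) + (1 - u) * W f (x + z r)) (indicator E))
       = u * (\<Sum>r\<in>?I. ip (\<lambda>x. V f (x + z r)) (indicator E))
         + (1 - u) * (\<Sum>r\<in>?I. ip (\<lambda>x. W f (x + z r)) (indicator E))"
      by (simp add: sum.distrib sum_distrib_left)
    then show ?case using convex by (simp only: convex_le)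
  qed
  obtain W where W: "W \<in> averaging G" "nsq (W f) < q\<^sup>2"
    using minsq_less_obtain[OF G(1) q(1)] .
  have bW: "bounded_fun (W f)" by (rule averaging_bounded[OF W(1) bf])
  have lower: "- q \<le> ip (\<lambda>x. W f (x + z r)) (indicator E)" for r
  proof -
    have "\<bar>ip (\<lambda>x. W f (x + z r)) (indicator E)\<bar> \<le> q"
      using bW W(2) q(2) nsq_shift[OF bW, of "z r"]
      by (intro ip_le_norm nsq_le_one) (auto simp: indicator_def)
    then show ?thesis by linarith
  qed
  have "real R * (- q) \<le> (\<Sum>r\<in>?I. ip (\<lambda>x. W f (x + z r)) (indicator E))"
    using sum_mono[of ?I "\<lambda>_. - q", OF lower] by simp
  also have "\<dots> \<le> real R * (C * e - a\<^sup>2)" by (rule upper[OF W(1)])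
  finally have "- q \<le> C * e - a\<^sup>2" by (rule mult_left_le_imp_le) (use R(1) in simp)
  then show False using C(2) by (simp add: a_def)
qed

text \<open>
  A function with mean zero that is at most \<open>c\<close> everywhere has \<open>L\<^sup>1\<close> norm at most \<open>2 c\<close>: an upper
  bound for the local densities alone already controls their variance.
\<close>
lemma minsq_le_of_upper_bound:
  fixes E :: "'a set"
  defines "f \<equiv> \<lambda>x. indicator E x - m (indicator E)"
  assumes W: "W \<in> averaging G" and le: "\<And>x. W (indicator E) x \<le> m (indicator E) + c"
    and c: "0 \<le> c"
  shows "minsq G f \<le> 2 * c"
proof -
  define a where "a = m (indicator E)"
  define g where "g = W f"
  have a: "0 \<le> a" "a \<le> 1"
    unfolding a_def using mean_mono[of "indicator E" "\<lambda>x. 1"]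
    by (auto simp: mean_one indicator_def intro!: mean_nonneg)
  have bf: "bounded_fun f" by (simp add: f_def)
  have bg: "bounded_fun g" unfolding g_def by (rule averaging_bounded[OF W bf])
  have "\<bar>f x\<bar> \<le> 1" for x using a by (auto simp: f_def a_def[symmetric] indicator_def)
  then have one: "\<bar>g x\<bar> \<le> 1" for x unfolding g_def by (rule averaging_le[OF W])
  have up: "g x \<le> c" for x
    using le[of x] averaging_diff_const[OF W, of "indicator E" a] by (simp add: g_def f_def a_def)
  have "m f = 0" unfolding f_def by (subst mean_diff) (auto simp: mean_const)
  then have mg: "m g = 0" unfolding g_def using mean_averaging[OF W bf] by simp
  have "g x * g x \<le> 2 * c - g x" for x
  proof -
    have "g x * g x = \<bar>g x\<bar> * \<bar>g x\<bar>" by simp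
    also have "\<dots> \<le> \<bar>g x\<bar> * 1" by (intro mult_left_mono one) auto
    also have "\<dots> \<le> 2 * c - g x" using up[of x] c by linarith
    finally show ?thesis .
  qed
  then have "nsq g \<le> m (\<lambda>x. 2 * c - g x)"
    unfolding ip_def using bg by (intro mean_mono) simp_all
  also have "\<dots> = 2 * c" using mg bg by (subst mean_diff) (simp_all add: mean_const)
  finally show ?thesis using minsq_le[OF W bf] by (simp add: g_def)
qed

end

section \<open>Sublattices spanned by columns of a unimodular matrix\<close>
definition transvection :: "'d \<Rightarrow> 'd \<Rightarrow> int \<Rightarrow> int ^ 'd ^ 'd" where
  "transvection i j t = (\<chi> a b. (if a = b then 1 else 0) + (if a = i \<and> b = j then t else 0))"

lemma transvection_mult:
  fixes x :: "int ^ 'd::finite"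
  shows "transvection i j t *v x = (\<chi> a. x $ a + (if a = i then t * x $ j else 0))"
proof -
  have "(\<Sum>b\<in>UNIV. ((if a = b then 1 else 0) + (if a = i \<and> b = j then t else 0)) * x $ b)
     = x $ a + (if a = i then t * x $ j else 0)" for a
  proof -
    have "((if a = b then 1 else 0) + (if a = i \<and> b = j then t else 0)) * x $ b
       = (if a = b then x $ b else 0) + (if j = b then (if a = i then t * x $ b else 0) else 0)" for b
      by (auto simp: distrib_right)
    then show ?thesis by (simp add: sum.distrib)
  qed
  then show ?thesis by (simp add: transvection_def matrix_vector_mult_def vec_eq_iff)
qed

lemma det_transvection:
  fixes i j :: "'d::finite"
  assumes "i \<noteq> j"
  shows "det (transvection i j t) = 1"
proof -
  have "transvection i j t = (\<chi> k. if k = i then row i (mat 1) + t *s row j (mat 1) else row k (mat 1))"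
    using assms by (auto simp: transvection_def vec_eq_iff row_def mat_def)
  then show ?thesis using det_row_operation[OF assms, of "mat 1" t] by simp
qed

definition sublattice :: "int ^ 'd ^ 'd \<Rightarrow> 'd set \<Rightarrow> int \<Rightarrow> (int ^ 'd::finite) set" where
  "sublattice \<gamma> S M = {\<gamma> *v x | x. (\<forall>a. a \<notin> S \<longrightarrow> x $ a = 0) \<and> (\<forall>a. M dvd x $ a)}"

lemma sublattice_add:
  "x \<in> sublattice \<gamma> S M \<Longrightarrow> y \<in> sublattice \<gamma> S M \<Longrightarrow> x + y \<in> sublattice \<gamma> S M"
proof -
  assume "x \<in> sublattice \<gamma> S M" "y \<in> sublattice \<gamma> S M"
  then obtain u v where "x = \<gamma> *v u" "\<forall>a. a \<notin> S \<longrightarrow> u $ a = 0" "\<forall>a. M dvd u $ a"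
    "y = \<gamma> *v v" "\<forall>a. a \<notin> S \<longrightarrow> v $ a = 0" "\<forall>a. M dvd v $ a"
    unfolding sublattice_def by blast
  then show ?thesis
    unfolding sublattice_def
    by (intro CollectI exI[of _ "u + v"]) (simp add: matrix_vector_right_distrib)
qed

lemma sublattice_uminus: "x \<in> sublattice \<gamma> S M \<Longrightarrow> - x \<in> sublattice \<gamma> S M"
proof -
  assume "x \<in> sublattice \<gamma> S M"
  then obtain u where "x = \<gamma> *v u" "\<forall>a. a \<notin> S \<longrightarrow> u $ a = 0" "\<forall>a. M dvd u $ a"
    unfolding sublattice_def by blast
  then show ?thesis
    unfolding sublattice_def
    by (intro CollectI exI[of _ "- u"]) (simp add: matrix_vector_mult_def vec_eq_iff sum_negf)
qed

lemma sublattice_nonempty: "sublattice \<gamma> S M \<noteq> {}"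
proof -
  have "\<gamma> *v 0 \<in> sublattice \<gamma> S M" unfolding sublattice_def by (intro CollectI exI[of _ 0]) simp
  then show ?thesis by blast
qed

text \<open>
  The transvection changes the basis of the lattice spanned by the columns in \<open>S\<close>, not the
  lattice.
\<close>
lemma sublattice_transvection:
  assumes "i \<in> S" "j \<in> S" "i \<noteq> j"
  shows "sublattice \<gamma> S M \<subseteq> sublattice (\<gamma> ** transvection i j t) S M"
proof
  fix z assume "z \<in> sublattice \<gamma> S M"
  then obtain x where x: "z = \<gamma> *v x" "\<And>a. a \<notin> S \<Longrightarrow> x $ a = 0" "\<And>a. M dvd x $ a"
    by (auto simp: sublattice_def)
  let ?y = "transvection i j (- t) *v x"
  have "transvection i j t *v ?y = x"
    using assms(3) by (simp add: transvection_mult vec_eq_iff)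
  then have "z = (\<gamma> ** transvection i j t) *v ?y"
    by (simp add: x(1) matrix_vector_mul_assoc[symmetric])
  moreover have "?y $ a = 0" if "a \<notin> S" for a
    using x(2) that assms by (auto simp: transvection_mult)
  moreover have "M dvd ?y $ a" for a using x(3) by (simp add: transvection_mult)
  ultimately show "z \<in> sublattice (\<gamma> ** transvection i j t) S M"
    unfolding sublattice_def by blast
qed

text \<open>
  With columns \<open>b\<^sub>i, b\<^sub>j\<close> of \<open>\<gamma>\<close>, the two lattices on the right contain \<open>M (b\<^sub>i + s b\<^sub>j)\<close> and
  \<open>M (b\<^sub>i + t b\<^sub>j)\<close> respectively. These span a subgroup of index \<open>\<bar>s - t\<bar>\<close> in the span of
  \<open>M b\<^sub>i\<close> and \<open>M b\<^sub>j\<close>, whence the factor \<open>K\<close>. Explicitly, the coefficient \<open>g\<close> of \<open>b\<^sub>i\<close> in the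
  first summand is the solution of \<open>s g + t (w\<^sub>i - g) = w\<^sub>j\<close>.
\<close>
lemma sublattice_split:
  fixes \<gamma> :: "int ^ 'd::finite ^ 'd"
  assumes ij: "i \<in> S" "j \<in> S" "i \<noteq> j" and st: "s \<noteq> t" "(s - t) dvd K"
    and z: "z \<in> sublattice \<gamma> S (M * K)"
  shows "\<exists>x\<in>sublattice (\<gamma> ** transvection j i s) (S - {j}) M.
         \<exists>y\<in>sublattice (\<gamma> ** transvection j i t) (S - {j}) M. z = x + y"
proof -
  obtain w where w: "z = \<gamma> *v w" "\<And>a. a \<notin> S \<Longrightarrow> w $ a = 0" "\<And>a. M * K dvd w $ a"
    using z by (auto simp: sublattice_def)
  have Mw: "M dvd w $ a" for a using w(3)[of a] by (rule dvd_mult_left)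
  obtain k where k: "K = (s - t) * k" using st(2) by blast
  have "M * K dvd w $ j - t * w $ i" using w(3) by simp
  then obtain c where c: "w $ j - t * w $ i = M * K * c" by blast
  define g where "g = M * k * c"
  have g: "(s - t) * g = w $ j - t * w $ i" unfolding c g_def k by (simp add: algebra_simps)
  have g': "s * g + t * (w $ i - g) = w $ j"
    using g by (simp add: left_diff_distrib right_diff_distrib)
  define x where "x = (\<chi> a. if a = i then g else if a = j then 0 else w $ a)"
  define y where "y = (\<chi> a. if a = i then w $ i - g else 0)"
  have "M dvd g" by (simp add: g_def mult.assoc)
  have xy: "x $ a = 0 \<and> y $ a = 0" if "a \<notin> S - {j}" for a
  proof -
    have "a \<noteq> i" "a = j \<or> w $ a = 0" using that ij w(2) by blast+
    then show ?thesis by (auto simp: x_def y_def)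
  qed
  have xyM: "M dvd x $ a" "M dvd y $ a" for a
    using \<open>M dvd g\<close> Mw by (simp_all add: x_def y_def)
  have "transvection j i s *v x + transvection j i t *v y = w"
    using ij(3) g' by (auto simp: transvection_mult vec_eq_iff x_def y_def)
  then have "z = \<gamma> *v (transvection j i s *v x) + \<gamma> *v (transvection j i t *v y)"
    by (metis w(1) matrix_vector_right_distrib)
  then have "z = (\<gamma> ** transvection j i s) *v x + (\<gamma> ** transvection j i t) *v y"
    by (simp only: matrix_vector_mul_assoc)
  moreover have "(\<gamma> ** transvection j i s) *v x \<in> sublattice (\<gamma> ** transvection j i s) (S - {j}) M"
    unfolding sublattice_def using xy xyM by blast
  moreover have "(\<gamma> ** transvection j i t) *v y \<in> sublattice (\<gamma> ** transvection j i t) (S - {j}) M"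
    unfolding sublattice_def using xy xyM by blast
  ultimately show ?thesis by blast
qed

section \<open>Descent to good directions\<close>

text \<open>
  The factor \<open>fact R\<close> is divisible by all differences of two distinct indices in a block of
  length \<open>R\<close>, so that \<open>sum_minsq_le\<close> applies to the block. The start \<open>l\<close> of the block is
  arbitrary, which is what \<open>exists_return\<close> asks for.
\<close>
lemma sum_minsq_sublattice_le:
  fixes m :: "(int ^ 'd::finite \<Rightarrow> real) \<Rightarrow> real" and l :: int
  assumes m: "invariant_mean m"
    and ij: "i \<in> S" "j \<in> S" "i \<noteq> j"
    and f: "\<And>x. \<bar>f x\<bar> \<le> 1"
    and \<epsilon>: "0 < \<epsilon>" and R: "R = nat \<lceil>4 / \<epsilon>\<rceil>"
    and small: "invariant_mean.minsq m (sublattice \<gamma> S (M * fact R)) f < (\<epsilon> / (2 * real R))\<^sup>2"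
  shows "(\<Sum>t\<in>{0..<int R}.
      invariant_mean.minsq m (sublattice (\<gamma> ** transvection j i (l + t)) (S - {j}) M) f) \<le> real R * \<epsilon>"
proof -
  interpret invariant_mean m by (rule m)
  have R4: "4 / \<epsilon> \<le> real R" unfolding R using \<epsilon> by linarith
  then have R4': "4 \<le> real R * \<epsilon>" using \<epsilon> by (simp add: field_simps)
  have R0: "0 < real R" using R4 \<epsilon> by (meson divide_pos_pos less_le_trans zero_less_numeral)
  let ?G = "\<lambda>t. sublattice (\<gamma> ** transvection j i (l + t)) (S - {j}) M"
  have dvd: "s - t dvd fact R" if "s \<in> {0..<int R}" "t \<in> {0..<int R}" "s \<noteq> t" for s t :: int
  proof -
    have "nat \<bar>s - t\<bar> dvd fact R" using that by (intro dvd_fact) auto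
    then have "int (nat \<bar>s - t\<bar>) dvd int (fact R)" by (simp only: of_nat_dvd_iff)
    then show ?thesis by simp
  qed
  have "(\<Sum>t\<in>{0..<int R}. minsq (?G t) f)
      \<le> 2 + (real (card {0..<int R}))\<^sup>2 * (\<epsilon> / (2 * real R))"
  proof (rule sum_minsq_le[where H = "sublattice \<gamma> S (M * fact R)"])
    show "{0..<int R} \<noteq> {}" using R0 by simp
    show "bounded_fun f" using f by (rule bounded_funI)
    show "nsq f \<le> 1" using f by (rule nsq_le_one)
    show "\<exists>x\<in>?G s. \<exists>y\<in>?G t. z = x + y"
      if st: "s \<in> {0..<int R}" "t \<in> {0..<int R}" "s \<noteq> t"
        and z: "z \<in> sublattice \<gamma> S (M * fact R)" for s t z
      by (rule sublattice_split[OF ij _ _ z]) (use st dvd[OF st] in auto)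
  qed (use sublattice_add sublattice_uminus sublattice_nonempty small \<epsilon> in simp_all)
  also have "\<dots> = 2 + real R * \<epsilon> / 2" using R0 by (simp add: power2_eq_square)
  also have "\<dots> \<le> real R * \<epsilon>" using R4' by simp
  finally show ?thesis .
qed

text \<open>
  One column is omitted at a time; each step costs a factor in the modulus and in the
  tolerance. These depend neither on \<open>m\<close> nor on \<open>f\<close>, which is the source of the uniformity of the
  final bound.
\<close>
lemma exists_small_plane:
  fixes i j :: "'d::finite"
  assumes ij: "i \<noteq> j" and U: "finite U" "i \<notin> U" "j \<notin> U" and \<epsilon>: "0 < \<epsilon>" and M: "0 < M"
  shows "\<exists>M'>0. \<exists>\<epsilon>'>0. \<forall>(m :: (int ^ 'd \<Rightarrow> real) \<Rightarrow> real) f \<gamma>. invariant_mean m \<longrightarrow> (\<forall>x. \<bar>f x\<bar> \<le> 1) \<longrightarrow>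
     det \<gamma> = 1 \<longrightarrow> invariant_mean.minsq m (sublattice \<gamma> ({i, j} \<union> U) M') f < \<epsilon>' \<longrightarrow>
     (\<exists>\<gamma>'. det \<gamma>' = 1 \<and> invariant_mean.minsq m (sublattice \<gamma>' {i, j} M) f < \<epsilon>)"
  using U
proof (induction U rule: finite_induct)
  case empty
  show ?case using \<epsilon> M by (intro exI[of _ M] exI[of _ \<epsilon>] conjI) auto
next
  case (insert k U)
  have k: "k \<noteq> i" "k \<noteq> j" "i \<notin> U" "j \<notin> U" using insert.prems by auto
  obtain M1 \<epsilon>1 where 1: "0 < M1" "0 < \<epsilon>1"
    and IH: "\<And>(m :: (int ^ 'd \<Rightarrow> real) \<Rightarrow> real) f \<gamma>. invariant_mean m \<Longrightarrow> (\<forall>x. \<bar>f x\<bar> \<le> 1) \<Longrightarrow>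
       det \<gamma> = 1 \<Longrightarrow> invariant_mean.minsq m (sublattice \<gamma> ({i, j} \<union> U) M1) f < \<epsilon>1 \<Longrightarrow>
       (\<exists>\<gamma>'. det \<gamma>' = 1 \<and> invariant_mean.minsq m (sublattice \<gamma>' {i, j} M) f < \<epsilon>)"
    using insert.IH[OF k(3,4)] by blast
  define \<epsilon>2 where "\<epsilon>2 = \<epsilon>1 / 2"
  define R where "R = nat \<lceil>4 / \<epsilon>2\<rceil>"
  have \<epsilon>2: "0 < \<epsilon>2" using 1 by (simp add: \<epsilon>2_def)
  then have R0: "0 < R" by (simp add: R_def)
  show ?case
  proof (rule exI[of _ "M1 * fact R"],
      intro conjI exI[of _ "(\<epsilon>2 / (2 * real R))\<^sup>2"] allI impI)
    show "0 < M1 * fact R" using \<open>0 < M1\<close> by simp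
    show "0 < (\<epsilon>2 / (2 * real R))\<^sup>2" using \<epsilon>2 R0 by simp
    fix m :: "(int ^ 'd \<Rightarrow> real) \<Rightarrow> real" and f and \<gamma> :: "int ^ 'd ^ 'd"
    assume m: "invariant_mean m" and f: "\<forall>x. \<bar>f x\<bar> \<le> 1" and \<gamma>: "det \<gamma> = 1"
      and small: "invariant_mean.minsq m (sublattice \<gamma> ({i, j} \<union> insert k U) (M1 * fact R)) f
        < (\<epsilon>2 / (2 * real R))\<^sup>2"
    let ?c = "\<lambda>t. invariant_mean.minsq m
       (sublattice (\<gamma> ** transvection k i (0 + t)) ({i, j} \<union> insert k U - {k}) M1) f"
    have S: "{i, j} \<union> insert k U - {k} = {i, j} \<union> U" using k insert.hyps by auto
    have "(\<Sum>t\<in>{0..<int R}. ?c t) \<le> real R * \<epsilon>2"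
      using k f by (intro sum_minsq_sublattice_le[OF m _ _ _ _ \<epsilon>2 R_def small]) auto
    have "\<exists>t\<in>{0..<int R}. ?c t < \<epsilon>1"
    proof (rule ccontr)
      assume "\<not> ?thesis"
      then have "(\<Sum>t\<in>{0..<int R}. \<epsilon>1) \<le> (\<Sum>t\<in>{0..<int R}. ?c t)"
        by (intro sum_mono) (simp add: not_less)
      also have "\<dots> \<le> real R * \<epsilon>2" by fact
      finally show False using R0 1 by (simp add: \<epsilon>2_def)
    qed
    then obtain t where t: "invariant_mean.minsq m
        (sublattice (\<gamma> ** transvection k i t) ({i, j} \<union> U) M1) f < \<epsilon>1" unfolding S by auto
    have "det (\<gamma> ** transvection k i t) = 1" using \<gamma> k by (simp add: det_mul det_transvection)
    from IH[OF m f this t]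
    show "\<exists>\<gamma>'. det \<gamma>' = 1 \<and> invariant_mean.minsq m (sublattice \<gamma>' {i, j} M) f < \<epsilon>" .
  qed
qed

text \<open>
  The plane spanned by the columns \<open>i\<close> and \<open>j\<close> is used twice. First a change of basis makes the
  column \<open>j\<close> a good direction \<open>u\<close>; then, in the new basis \<open>b, u\<close> of the same plane, the directions
  \<open>b + l u\<close> are good on average over every block.
\<close>
lemma exists_small_directions:
  fixes i j :: "'d::finite"
  assumes ij: "i \<noteq> j" and \<epsilon>: "0 < \<epsilon>" and M: "0 < M"
  shows "\<exists>M'>0. \<exists>\<epsilon>'>0. \<exists>R>0. \<forall>(m :: (int ^ 'd \<Rightarrow> real) \<Rightarrow> real) f. invariant_mean m \<longrightarrow> (\<forall>x. \<bar>f x\<bar> \<le> 1) \<longrightarrow>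
     invariant_mean.minsq m (sublattice (mat 1) UNIV M') f < \<epsilon>' \<longrightarrow>
     (\<exists>\<gamma>. det \<gamma> = 1 \<and> invariant_mean.minsq m (sublattice \<gamma> {j} M) f \<le> \<epsilon> \<and>
       (\<forall>l. (\<Sum>t\<in>{0..<int R}. invariant_mean.minsq m
          (sublattice (\<gamma> ** transvection j i (l + t)) {i} M) f) \<le> real R * \<epsilon>))"
proof -
  define R where "R = nat \<lceil>4 / \<epsilon>\<rceil>"
  have R0: "0 < R" using \<epsilon> by (simp add: R_def)
  define M1 \<epsilon>1 where "M1 = M * fact R" and "\<epsilon>1 = (\<epsilon> / (2 * real R))\<^sup>2"
  have 1: "0 < M1" "0 < \<epsilon>1" using M \<epsilon> R0 by (auto simp: M1_def \<epsilon>1_def)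
  have U: "finite (UNIV - {i, j})" "i \<notin> UNIV - {i, j}" "j \<notin> UNIV - {i, j}" by auto
  have UN: "{i, j} \<union> (UNIV - {i, j}) = UNIV" by auto
  obtain M' \<epsilon>' where M': "0 < M'" "0 < \<epsilon>'"
    and plane: "\<And>(m :: (int ^ 'd \<Rightarrow> real) \<Rightarrow> real) f \<gamma>. invariant_mean m \<Longrightarrow> (\<forall>x. \<bar>f x\<bar> \<le> 1) \<Longrightarrow>
     det \<gamma> = 1 \<Longrightarrow> invariant_mean.minsq m (sublattice \<gamma> UNIV M') f < \<epsilon>' \<Longrightarrow>
     (\<exists>\<gamma>'. det \<gamma>' = 1 \<and> invariant_mean.minsq m (sublattice \<gamma>' {i, j} M1) f < \<epsilon>1)"
    using exists_small_plane[OF ij U 1(2,1)] unfolding UN by blast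
  show ?thesis
  proof (rule exI[of _ M'], intro conjI M', rule exI[of _ \<epsilon>'], intro conjI M', rule exI[of _ R],
      intro conjI R0 allI impI)
    fix m :: "(int ^ 'd \<Rightarrow> real) \<Rightarrow> real" and f
    assume m: "invariant_mean m" and f: "\<forall>x. \<bar>f x\<bar> \<le> 1"
      and small: "invariant_mean.minsq m (sublattice (mat 1) UNIV M') f < \<epsilon>'"
    interpret invariant_mean m by (rule m)
    obtain \<gamma> where \<gamma>: "det \<gamma> = 1" "minsq (sublattice \<gamma> {i, j} M1) f < \<epsilon>1"
      using plane[OF m f det_I small] by blast
    have bf: "bounded_fun f" using f by (auto intro: bounded_funI)
    let ?c = "\<lambda>t. minsq (sublattice (\<gamma> ** transvection i j (0 + t)) ({i, j} - {i}) M) f"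
    have sum: "(\<Sum>t\<in>{0..<int R}. ?c t) \<le> real R * \<epsilon>"
      using ij f \<gamma>(2) by (intro sum_minsq_sublattice_le[OF m _ _ _ _ \<epsilon> R_def])
        (auto simp: M1_def \<epsilon>1_def)
    have "\<exists>t\<in>{0..<int R}. ?c t \<le> \<epsilon>"
    proof (rule ccontr)
      assume "\<not> ?thesis"
      then have "\<epsilon> < ?c t" if "t \<in> {0..<int R}" for t using that by (meson not_le)
      then have "(\<Sum>t\<in>{0..<int R}. \<epsilon>) < (\<Sum>t\<in>{0..<int R}. ?c t)"
        using R0 by (intro sum_strict_mono) simp_all
      then show False using sum by simp
    qed
    then obtain t where t: "minsq (sublattice (\<gamma> ** transvection i j t) {j} M) f \<le> \<epsilon>"
      using ij by (auto simp: insert_Diff_if)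
    let ?\<gamma> = "\<gamma> ** transvection i j t"
    have "minsq (sublattice ?\<gamma> {i, j} M1) f \<le> minsq (sublattice \<gamma> {i, j} M1) f"
      using ij bf by (intro minsq_antimono sublattice_nonempty sublattice_transvection) auto
    then have small1: "minsq (sublattice ?\<gamma> {i, j} (M * fact R)) f < (\<epsilon> / (2 * real R))\<^sup>2"
      using \<gamma>(2) by (simp add: M1_def \<epsilon>1_def)
    have "(\<Sum>t\<in>{0..<int R}. minsq (sublattice (?\<gamma> ** transvection j i (l + t)) ({i, j} - {j}) M) f)
        \<le> real R * \<epsilon>" for l
      using ij f by (intro sum_minsq_sublattice_le[OF m _ _ _ _ \<epsilon> R_def small1]) auto
    moreover have "{i, j} - {j} = {i}" using ij by auto
    moreover have "det ?\<gamma> = 1" using \<gamma> ij by (simp add: det_mul det_transvection)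
    ultimately show "\<exists>\<gamma>. det \<gamma> = 1 \<and> minsq (sublattice \<gamma> {j} M) f \<le> \<epsilon> \<and>
       (\<forall>l. (\<Sum>t\<in>{0..<int R}. minsq (sublattice (\<gamma> ** transvection j i (l + t)) {i} M) f) \<le> real R * \<epsilon>)"
      using t by (intro exI[of _ ?\<gamma>]) simp
  qed
qed

section \<open>Moving vectors by unimodular matrices\<close>

text \<open>
  The Euclidean algorithm on the coordinates \<open>i\<close> and \<open>j\<close>. When \<open>x\<^sub>j\<close> divides \<open>x\<^sub>i\<close>, the gcd sits in
  coordinate \<open>j\<close>; it is first copied to coordinate \<open>i\<close> and then subtracted.
\<close>
lemma euclid_transvections:
  fixes x :: "int ^ 'd::finite"
  assumes ij: "i \<noteq> j"
  shows "\<exists>\<gamma> :: int ^ 'd ^ 'd. det \<gamma> = 1 \<and> (\<gamma> *v x) $ j = 0 \<and> (\<forall>k. k \<noteq> i \<longrightarrow> k \<noteq> j \<longrightarrow> (\<gamma> *v x) $ k = x $ k)"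
proof (induction "nat \<bar>x $ j\<bar>" arbitrary: x rule: less_induct)
  case (less x)
  have step: "\<exists>\<gamma> :: int ^ 'd ^ 'd. det \<gamma> = 1 \<and> (\<gamma> *v x) $ j = 0 \<and> (\<forall>k. k \<noteq> i \<longrightarrow> k \<noteq> j \<longrightarrow> (\<gamma> *v x) $ k = x $ k)"
    if "det \<delta> = 1" "\<forall>k. k \<noteq> i \<longrightarrow> k \<noteq> j \<longrightarrow> (\<delta> *v x) $ k = x $ k"
      "det \<gamma> = 1" "(\<gamma> *v (\<delta> *v x)) $ j = 0"
      "\<forall>k. k \<noteq> i \<longrightarrow> k \<noteq> j \<longrightarrow> (\<gamma> *v (\<delta> *v x)) $ k = (\<delta> *v x) $ k" for \<gamma> \<delta> :: "int ^ 'd ^ 'd"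
    using that by (intro exI[of _ "\<gamma> ** \<delta>"]) (simp add: det_mul matrix_vector_mul_assoc[symmetric])
  consider "x $ j = 0" | "x $ j \<noteq> 0" "x $ i mod x $ j = 0" | "x $ j \<noteq> 0" "x $ i mod x $ j \<noteq> 0"
    by blast
  then show ?case
  proof cases
    case 1
    then show ?thesis by (intro exI[of _ "mat 1"]) simp
  next
    case 2
    define \<delta> where "\<delta> = transvection i j (1 - x $ i div x $ j)"
    have "x $ i = x $ i div x $ j * x $ j" using 2(2) by (simp add: mod_eq_0_iff_dvd)
    then have "(\<delta> *v x) $ i = x $ j"
      unfolding \<delta>_def transvection_mult by (simp add: left_diff_distrib)
    then show ?thesis
      using ij
      by (intro step[of \<delta> "transvection j i (- 1)"])
         (auto simp: \<delta>_def det_transvection transvection_mult)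
  next
    case 3
    define r where "r = x $ i mod x $ j"
    define \<delta> where "\<delta> = transvection j i (- (x $ j div r)) ** transvection i j (- (x $ i div x $ j))"
    have "x $ i + - (x $ i div x $ j) * x $ j = r"
      by (simp add: r_def minus_div_mult_eq_mod[symmetric])
    then have \<delta>: "(\<delta> *v x) $ j = x $ j mod r" "\<forall>k. k \<noteq> i \<longrightarrow> k \<noteq> j \<longrightarrow> (\<delta> *v x) $ k = x $ k"
      using ij
      by (auto simp: \<delta>_def transvection_mult matrix_vector_mul_assoc[symmetric]
          minus_div_mult_eq_mod[symmetric])
    have "\<bar>r\<bar> < \<bar>x $ j\<bar>" "\<bar>x $ j mod r\<bar> < \<bar>r\<bar>"
      using 3 by (auto simp: r_def intro: abs_mod_less)
    then have "nat \<bar>(\<delta> *v x) $ j\<bar> < nat \<bar>x $ j\<bar>" using \<delta>(1) by simp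
    from less[OF this] obtain \<gamma> where "det \<gamma> = 1" "(\<gamma> *v (\<delta> *v x)) $ j = 0"
      "\<forall>k. k \<noteq> i \<longrightarrow> k \<noteq> j \<longrightarrow> (\<gamma> *v (\<delta> *v x)) $ k = (\<delta> *v x) $ k" by blast
    moreover have "det \<delta> = 1" using ij by (simp add: \<delta>_def det_mul det_transvection)
    ultimately show ?thesis using \<delta>(2) by (intro step[of \<delta> \<gamma>])
  qed
qed

lemma exists_SL_to_axis:
  fixes x :: "int ^ 'd::finite"
  shows "\<exists>\<gamma> a. det \<gamma> = 1 \<and> \<gamma> *v x = a *s axis i 1"
proof -
  have "\<exists>\<gamma> :: int ^ 'd ^ 'd. det \<gamma> = 1 \<and> (\<forall>j\<in>U. (\<gamma> *v x) $ j = 0)" if "finite U" "i \<notin> U" for U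
    using that
  proof (induction U rule: finite_induct)
    case empty
    show ?case by (intro exI[of _ "mat 1"]) simp
  next
    case (insert j U)
    then obtain \<gamma> :: "int ^ 'd ^ 'd" where \<gamma>: "det \<gamma> = 1" "\<forall>j\<in>U. (\<gamma> *v x) $ j = 0" by auto
    have "i \<noteq> j" using insert by auto
    from euclid_transvections[OF this, of "\<gamma> *v x"] obtain \<delta> :: "int ^ 'd ^ 'd"
      where "det \<delta> = 1" "(\<delta> *v (\<gamma> *v x)) $ j = 0"
        "\<forall>k. k \<noteq> i \<longrightarrow> k \<noteq> j \<longrightarrow> (\<delta> *v (\<gamma> *v x)) $ k = (\<gamma> *v x) $ k" by blast
    moreover have "(\<delta> *v (\<gamma> *v x)) $ k = 0" if "k \<in> U" for k
      using calculation \<gamma>(2) that insert.prems by (cases "k = j") auto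
    ultimately show ?case
      using \<gamma>(1) by (intro exI[of _ "\<delta> ** \<gamma>"]) (auto simp: det_mul matrix_vector_mul_assoc[symmetric])
  qed
  from this[of "UNIV - {i}"] obtain \<gamma> :: "int ^ 'd ^ 'd"
    where "det \<gamma> = 1" "\<forall>j\<in>UNIV - {i}. (\<gamma> *v x) $ j = 0" by auto
  then show ?thesis
    by (intro exI[of _ \<gamma>] exI[of _ "(\<gamma> *v x) $ i"]) (auto simp: vec_eq_iff axis_def)
qed

lemma det_replace_row:
  fixes x :: "int ^ 'd::finite"
  shows "det (\<chi> k. if k = r then x else c k) =
    (\<Sum>b\<in>UNIV. x $ b * det (\<chi> k. if k = r then axis b 1 else c k))"
proof -
  have "det (\<chi> k. if k = r then x else c k)
      = det (\<chi> k. if k = r then (\<Sum>b\<in>UNIV. x $ b *s axis b 1) else c k)"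
    by (simp only: basis_expansion)
  also have "\<dots> = (\<Sum>b\<in>UNIV. det (\<chi> k. if k = r then x $ b *s axis b 1 else c k))"
    by (rule det_linear_row_sum) simp
  finally show ?thesis by (simp only: det_row_mul)
qed

text \<open>
  Cramer's rule without division: the determinant with \<open>v\<^sub>r\<close> replaced by \<open>x\<close> is linear in \<open>x\<close>,
  has the value \<open>det v\<close> at \<open>x = v\<^sub>r\<close> and vanishes at the other columns. The vector \<open>w\<close> represents
  the linear combination of these functionals with weights \<open>n\<^sub>r\<close>.
\<close>
lemma exists_dual_functional:
  fixes v :: "'d::finite \<Rightarrow> int ^ 'd"
  shows "\<exists>w :: int ^ 'd. \<forall>k. (\<Sum>b\<in>UNIV. w $ b * v k $ b) = det (matrix_of_columns v) * n k"
proof -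
  define w where "w = (\<chi> b. \<Sum>r\<in>UNIV. n r * det (\<chi> k. if k = r then axis b 1 else v k))"
  have "matrix_of_columns v = transpose (\<chi> r. v r)"
    by (simp add: matrix_of_columns_def transpose_def)
  then have det: "det (matrix_of_columns v) = det (\<chi> r. v r)" by (simp add: det_transpose)
  have "(\<Sum>b\<in>UNIV. w $ b * v k $ b) = det (matrix_of_columns v) * n k" for k
  proof -
    have "(\<Sum>b\<in>UNIV. w $ b * v k $ b)
        = (\<Sum>b\<in>UNIV. \<Sum>r\<in>UNIV. n r * (v k $ b * det (\<chi> k. if k = r then axis b 1 else v k)))"
      by (simp add: w_def sum_distrib_right mult.assoc mult.commute[of "v k $ _"])
    also have "\<dots> = (\<Sum>r\<in>UNIV. \<Sum>b\<in>UNIV. n r * (v k $ b * det (\<chi> k. if k = r then axis b 1 else v k)))"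
      by (rule sum.swap)
    also have "\<dots> = (\<Sum>r\<in>UNIV. n r * det (\<chi> s. if s = r then v k else v s))"
      unfolding det_replace_row[of _ "v k"] by (simp add: sum_distrib_left)
    also have "\<dots> = (\<Sum>r\<in>UNIV. if r = k then n k * det (\<chi> r. v r) else 0)"
    proof (rule sum.cong[OF refl])
      fix r
      have "det (\<chi> s. if s = r then v k else v s) = 0" if "r \<noteq> k"
        by (rule det_identical_rows[OF that]) (use that in \<open>auto simp: row_def\<close>)
      moreover have "(\<chi> s. if s = k then v k else v s) = (\<chi> r. v r)" by (simp add: vec_eq_iff)
      ultimately show "n r * det (\<chi> s. if s = r then v k else v s)
          = (if r = k then n k * det (\<chi> r. v r) else 0)" by auto
    qed
    finally show ?thesis by (simp add: det)
  qed
  then show ?thesis by blast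
qed

lemma exists_shear:
  fixes w :: "int ^ 'd::finite"
  assumes "w $ i = 0"
  shows "\<exists>\<sigma> :: int ^ 'd ^ 'd. det \<sigma> = 1 \<and> (\<forall>x. \<sigma> *v x = x + (\<Sum>b\<in>UNIV. w $ b * x $ b) *s axis i 1)"
proof -
  define \<sigma> :: "int ^ 'd ^ 'd" where "\<sigma> = (\<chi> k. if k = i then axis i 1 + w else axis k 1)"
  have "(\<Sum>b\<in>UNIV. axis k 1 $ b * x $ b) = x $ k" for k and x :: "int ^ 'd"
  proof -
    have "axis k 1 $ b * x $ b = (if k = b then x $ b else 0)" for b by (simp add: axis_def)
    then show ?thesis by simp
  qed
  then have "\<sigma> *v x = x + (\<Sum>b\<in>UNIV. w $ b * x $ b) *s axis i 1" for x
    by (auto simp: \<sigma>_def matrix_vector_mult_def vec_eq_iff distrib_right sum.distrib axis_def)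
  moreover have "det \<sigma> = 1"
  proof -
    have "det \<sigma> = det (\<chi> k. if k = i then axis i 1 else axis k (1::int))
        + det (\<chi> k. if k = i then w else axis k 1)"
      unfolding \<sigma>_def by (rule det_row_add)
    also have "(\<chi> k. if k = i then axis i 1 else axis k (1::int)) = mat 1"
      by (auto simp: vec_eq_iff axis_def mat_def)
    also have "det (\<chi> k. if k = i then w else axis k (1::int)) = 0"
      unfolding det_replace_row[of i w]
    proof (intro sum.neutral ballI)
      fix b
      have "det (\<chi> k. if k = i then axis b 1 else axis k (1::int)) = 0" if "b \<noteq> i"
        by (rule det_identical_rows[OF that]) (use that in \<open>auto simp: row_def\<close>)
      then show "w $ b * det (\<chi> k. if k = i then axis b 1 else axis k (1::int)) = 0"
        using assms by (cases "b = i") auto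
    qed
    finally show ?thesis by simp
  qed
  ultimately show ?thesis by blast
qed

lemma int_matrix_scalar_commute:
  fixes A :: "int ^ 'n ^ 'm"
  shows "A *v (c *s x) = c *s (A *v x)"
  by (simp add: vec_eq_iff matrix_vector_mult_def sum_distrib_left mult.left_commute)

text \<open>
  The shear \<open>x \<mapsto> x + w(x) e\<^sub>i\<close> with the functional \<open>w\<close> of \<open>exists_dual_functional\<close> is unimodular
  as soon as \<open>w(e\<^sub>i) = 0\<close>, and this follows from \<open>w(v\<^sub>i) = 0\<close> because \<open>v\<^sub>i\<close> is a nonzero multiple of \<open>e\<^sub>i\<close>.
\<close>
lemma exists_SL_with_prescribed_displacements:
  fixes v :: "'d::finite \<Rightarrow> int ^ 'd" and \<gamma> :: "int ^ 'd ^ 'd"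
  assumes v: "v i = a *s axis i 1" "a \<noteq> 0" and n: "n i = 0" and \<gamma>: "det \<gamma> = 1"
  shows "\<exists>\<gamma>'. det \<gamma>' = 1 \<and> (\<forall>k. \<gamma>' *v v k
     = \<gamma> *v v k + (det (matrix_of_columns v) * n k) *s (\<gamma> *v axis i 1))"
proof -
  obtain w :: "int ^ 'd" where w: "\<And>k. (\<Sum>b\<in>UNIV. w $ b * v k $ b) = det (matrix_of_columns v) * n k"
    using exists_dual_functional by blast
  have "(\<Sum>b\<in>UNIV. w $ b * v i $ b) = (\<Sum>b\<in>UNIV. if b = i then w $ i * a else 0)"
    unfolding v(1) by (intro sum.cong) (auto simp: axis_def)
  then have "w $ i = 0" using w[of i] n v(2) by simp
  then obtain \<sigma> :: "int ^ 'd ^ 'd" where \<sigma>: "det \<sigma> = 1"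
      "\<And>x. \<sigma> *v x = x + (\<Sum>b\<in>UNIV. w $ b * x $ b) *s axis i 1"
    using exists_shear by blast
  have "(\<gamma> ** \<sigma>) *v v k = \<gamma> *v v k + (det (matrix_of_columns v) * n k) *s (\<gamma> *v axis i 1)" for k
    by (simp add: matrix_vector_mul_assoc[symmetric] \<sigma>(2) w matrix_vector_right_distrib int_matrix_scalar_commute)
  then show ?thesis using \<sigma>(1) \<gamma> by (intro exI[of _ "\<gamma> ** \<sigma>"]) (simp add: det_mul)
qed

section \<open>Simplices in regular sets\<close>

text \<open>
  Only \<open>M'\<close> and \<open>\<epsilon>'\<close> are fixed in advance; the direction \<open>p l\<close> may depend on \<open>v\<close>. For a suitable
  \<open>l\<close> the pairs of points of \<open>E\<close> with difference \<open>a p\<^sub>l\<close> have larger mean than the points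
  \<open>x\<close> for which one of the \<open>d - 1\<close> progressions \<open>x + \<gamma> v\<^sub>k + M \<int> p\<^sub>l\<close> misses \<open>E\<close>.
\<close>
lemma regular_set_contains_simplices:
  fixes D :: nat and a0 :: real
  assumes card: "2 \<le> CARD('d::finite)" and D: "0 < D" and a0: "0 < a0"
  shows "\<exists>M>0. \<exists>\<epsilon>>0. \<forall>(m :: (int ^ 'd \<Rightarrow> real) \<Rightarrow> real) E. invariant_mean m \<longrightarrow> a0 \<le> m (indicator E) \<longrightarrow>
     invariant_mean.minsq m (sublattice (mat 1) UNIV M) (\<lambda>x. indicator E x - m (indicator E)) < \<epsilon> \<longrightarrow>
     (\<forall>v :: 'd \<Rightarrow> int ^ 'd. 0 < \<bar>det (matrix_of_columns v)\<bar> \<and> \<bar>det (matrix_of_columns v)\<bar> \<le> int D \<longrightarrow>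
        (\<exists>v0\<in>E. \<exists>\<gamma>\<in>SL_int. \<forall>i. v0 + \<gamma> *v v i \<in> E))"
proof -
  define d where "d = real (CARD('d))"
  have d: "0 < d" using card by (simp add: d_def)
  obtain i j :: 'd where ij: "i \<noteq> j"
  proof -
    have "\<exists>i j :: 'd. i \<noteq> j"
    proof (rule ccontr)
      assume "\<not> ?thesis"
      then have "(UNIV :: 'd set) \<subseteq> {undefined}" by auto
      then have "CARD('d) \<le> card {undefined :: 'd}" by (intro card_mono) auto
      then show False using card by simp
    qed
    then show ?thesis using that by blast
  qed
  \<comment> \<open>With \<open>q = a0\<^sup>2 / 2\<close> this meets the two conditions of \<open>exists_return\<close>, shown next.\<close>
  define \<epsilon> where "\<epsilon> = a0 ^ 4 / (4 * d + 5)"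
  have \<epsilon>: "0 < \<epsilon>" using a0 d by (simp add: \<epsilon>_def)
  have \<epsilon>1: "\<epsilon> < (a0\<^sup>2 / 2)\<^sup>2"
  proof -
    have "\<epsilon> < a0 ^ 4 / 4" unfolding \<epsilon>_def using a0 d by (intro divide_strict_left_mono) auto
    also have "\<dots> = (a0\<^sup>2 / 2)\<^sup>2" by (simp add: power_divide)
    finally show ?thesis .
  qed
  have \<epsilon>2: "d / a0\<^sup>2 * \<epsilon> + a0\<^sup>2 / 2 < a0\<^sup>2"
  proof -
    have "d / a0\<^sup>2 * \<epsilon> = a0\<^sup>2 * (d / (4 * d + 5))"
      using a0 by (simp add: \<epsilon>_def power2_eq_square power4_eq_xxxx)
    also have "\<dots> < a0\<^sup>2 * (1 / 2)" using a0 d by (intro mult_strict_left_mono) (auto simp: field_simps)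
    finally show ?thesis by linarith
  qed
  define M :: int where "M = fact D"
  have M: "0 < M" by (simp add: M_def)
  obtain M' \<epsilon>' R where M': "0 < M'" "0 < \<epsilon>'" "0 < R"
    and dirs: "\<And>(m :: (int ^ 'd \<Rightarrow> real) \<Rightarrow> real) f. invariant_mean m \<Longrightarrow> (\<forall>x. \<bar>f x\<bar> \<le> 1) \<Longrightarrow>
     invariant_mean.minsq m (sublattice (mat 1) UNIV M') f < \<epsilon>' \<Longrightarrow>
     (\<exists>\<gamma>. det \<gamma> = 1 \<and> invariant_mean.minsq m (sublattice \<gamma> {j} M) f \<le> \<epsilon> \<and>
       (\<forall>l. (\<Sum>t\<in>{0..<int R}. invariant_mean.minsq m
          (sublattice (\<gamma> ** transvection j i (l + t)) {i} M) f) \<le> real R * \<epsilon>))"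
    using exists_small_directions[OF ij \<epsilon> M] by blast
  show ?thesis
  proof (rule exI[of _ M'], intro conjI M', rule exI[of _ \<epsilon>'], intro conjI M' allI impI, elim conjE)
    fix m :: "(int ^ 'd \<Rightarrow> real) \<Rightarrow> real" and E and v :: "'d \<Rightarrow> int ^ 'd"
    assume m: "invariant_mean m" and mE: "a0 \<le> m (indicator E)"
      and small: "invariant_mean.minsq m (sublattice (mat 1) UNIV M')
         (\<lambda>x. indicator E x - m (indicator E)) < \<epsilon>'"
      and v: "0 < \<bar>det (matrix_of_columns v)\<bar>" "\<bar>det (matrix_of_columns v)\<bar> \<le> int D"
    interpret invariant_mean m by (rule m)
    let ?f = "\<lambda>x. indicator E x - m (indicator E)" and ?\<alpha> = "m (indicator E)"
    define \<Delta> where "\<Delta> = det (matrix_of_columns v)"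
    have \<alpha>: "0 < ?\<alpha>" "?\<alpha> \<le> 1"
      using a0 mE mean_mono[of "indicator E" "\<lambda>x. 1"] by (auto simp: mean_one indicator_def)
    have f1: "\<forall>x. \<bar>?f x\<bar> \<le> 1" using \<alpha> by (auto simp: indicator_def)
    have dvd: "c dvd M" if "c dvd \<Delta>" for c
    proof -
      have "nat \<bar>\<Delta>\<bar> dvd fact D" using v by (intro dvd_fact) (auto simp: \<Delta>_def)
      then have "int (nat \<bar>\<Delta>\<bar>) dvd int (fact D)" by (simp only: of_nat_dvd_iff)
      then have "\<Delta> dvd M" by (simp add: M_def)
      then show ?thesis using that by (rule dvd_trans[rotated])
    qed
    \<comment> \<open>It is harmless to apply a unimodular matrix to all columns, so column \<open>i\<close> may be assumed to
      lie on an axis.\<close>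
    obtain \<gamma>0 a where \<gamma>0: "det \<gamma>0 = 1" "\<gamma>0 *v v i = a *s axis i 1"
      using exists_SL_to_axis by blast
    define v' where "v' k = \<gamma>0 *v v k" for k
    have "matrix_of_columns v' = \<gamma>0 ** matrix_of_columns v"
      by (simp add: matrix_of_columns_def v'_def matrix_vector_mult_def matrix_matrix_mult_def vec_eq_iff)
    then have det': "det (matrix_of_columns v') = \<Delta>" using \<gamma>0 by (simp add: det_mul \<Delta>_def)
    have v'i: "v' i = a *s axis i 1" using \<gamma>0(2) by (simp add: v'_def)
    have a_dvd: "a dvd \<Delta>"
    proof -
      have "matrix_of_columns v' = transpose (\<chi> k. if k = i then a *s axis i 1 else v' k)"
        using v'i by (auto simp: matrix_of_columns_def transpose_def vec_eq_iff)
      then have "\<Delta> = det (\<chi> k. if k = i then a *s axis i 1 else v' k)"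
        using det' by (simp add: det_transpose)
      then show ?thesis by (simp only: det_row_mul dvd_triv_left)
    qed
    have a0': "a \<noteq> 0" using a_dvd v by (auto simp: \<Delta>_def)
    obtain \<gamma>1 where \<gamma>1: "det \<gamma>1 = 1" "minsq (sublattice \<gamma>1 {j} M) ?f \<le> \<epsilon>"
      and sums: "\<And>l. (\<Sum>t\<in>{0..<int R}. minsq (sublattice (\<gamma>1 ** transvection j i (l + t)) {i} M) ?f)
         \<le> real R * \<epsilon>"
      using dirs[OF m f1 small] by blast
    define p where "p l = \<gamma>1 *v axis i 1 + l *s (\<gamma>1 *v axis j 1)" for l
    have p: "(\<gamma>1 ** transvection j i l) *v axis i 1 = p l" for l
    proof -
      have "transvection j i l *v axis i 1 = axis i 1 + l *s axis j 1"
        by (auto simp: transvection_mult vec_eq_iff axis_def)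
      then show ?thesis
        by (simp add: p_def matrix_vector_mul_assoc[symmetric] matrix_vector_right_distrib
            int_matrix_scalar_commute)
    qed
    have line: "\<exists>h. y = (M * h) *s (\<gamma> *v axis k 1)" if y: "y \<in> sublattice \<gamma> {k} M"
      for y k and \<gamma> :: "int ^ 'd ^ 'd"
    proof -
      obtain x where x: "y = \<gamma> *v x" "\<And>b. b \<noteq> k \<Longrightarrow> x $ b = 0" "M dvd x $ k"
        using y by (auto simp: sublattice_def)
      obtain h where "x $ k = M * h" using x(3) by blast
      then have "x = (M * h) *s axis k 1" using x(2) by (auto simp: vec_eq_iff axis_def)
      then show ?thesis using x(1) int_matrix_scalar_commute by blast
    qed
    let ?z = "\<lambda>l. a *s p l" and ?G = "\<lambda>l. sublattice (\<gamma>1 ** transvection j i l) {i} M"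
    have "\<exists>l. d / ?\<alpha>\<^sup>2 * minsq (?G l) ?f < m (\<lambda>x. indicator E x * indicator E (x + ?z l))"
    proof (rule exists_return[where G = "sublattice \<gamma>1 {j} M" and q = "a0\<^sup>2 / 2" and R = R and e = \<epsilon>])
      fix y assume "y \<in> sublattice \<gamma>1 {j} M"
      then obtain h where h: "y = (M * h) *s (\<gamma>1 *v axis j 1)" using line by blast
      obtain c where c: "M = a * c" using dvd[OF a_dvd] by blast
      have "?z r + y = ?z (c * h + r)" for r
        by (simp add: h c p_def vec_eq_iff algebra_simps)
      then show "\<exists>l. \<forall>r. ?z r + y = ?z (l + r)" by blast
    next
      show "minsq (sublattice \<gamma>1 {j} M) ?f < (a0\<^sup>2 / 2)\<^sup>2" using \<gamma>1(2) \<epsilon>1 by linarith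
      have "a0\<^sup>2 \<le> ?\<alpha>\<^sup>2" using mE a0 by (intro power_mono) auto
      moreover from this have "d / ?\<alpha>\<^sup>2 * \<epsilon> \<le> d / a0\<^sup>2 * \<epsilon>"
        using d a0 \<alpha> \<epsilon> by (intro mult_right_mono divide_left_mono) auto
      ultimately show "d / ?\<alpha>\<^sup>2 * \<epsilon> + a0\<^sup>2 / 2 < ?\<alpha>\<^sup>2" using \<epsilon>2 by linarith
    qed (use sums M' d sublattice_nonempty in simp_all)
    then obtain l where l: "d / ?\<alpha>\<^sup>2 * minsq (?G l) ?f < m (\<lambda>x. indicator E x * indicator E (x + ?z l))"
      by blast
    define \<gamma> where "\<gamma> = \<gamma>1 ** transvection j i l"
    have \<gamma>: "det \<gamma> = 1" using \<gamma>1(1) ij by (simp add: \<gamma>_def det_mul det_transvection)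
    let ?B = "{x. \<forall>y\<in>?G l. x + y \<notin> E}"
    have B0: "0 \<le> m (indicator ?B)" by (intro mean_nonneg) auto
    have "real (card (UNIV - {i})) * m (indicator ?B) \<le> d * m (indicator ?B)"
      using B0 card_mono[of UNIV "UNIV - {i}"] by (intro mult_right_mono) (auto simp: d_def)
    also have "\<dots> = d / ?\<alpha>\<^sup>2 * (?\<alpha>\<^sup>2 * m (indicator ?B))" using \<alpha> by simp
    also have "\<dots> \<le> d / ?\<alpha>\<^sup>2 * minsq (?G l) ?f"
      using d by (intro mult_left_mono mean_avoiding_le sublattice_nonempty) auto
    also note l
    finally have "real (card (UNIV - {i})) * m (indicator ?B)
      < m (\<lambda>x. indicator E x * indicator E (x + ?z l))" .
    from exists_point_avoiding_shifts[OF _ this, of "\<lambda>k. \<gamma> *v v' k"]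
    obtain x where x: "x \<in> E" "x + ?z l \<in> E"
      and hit: "\<And>k. k \<noteq> i \<Longrightarrow> \<exists>y\<in>?G l. x + \<gamma> *v v' k + y \<in> E" by auto
    have "\<forall>k. \<exists>h. k \<noteq> i \<longrightarrow> x + \<gamma> *v v' k + (M * h) *s p l \<in> E"
    proof
      fix k
      show "\<exists>h. k \<noteq> i \<longrightarrow> x + \<gamma> *v v' k + (M * h) *s p l \<in> E"
        using hit[of k] line[of _ "\<gamma>1 ** transvection j i l" i] unfolding p by metis
    qed
    then obtain h where h: "\<And>k. k \<noteq> i \<Longrightarrow> x + \<gamma> *v v' k + (M * h k) *s p l \<in> E" by metis
    obtain c where c: "M = \<Delta> * c" using dvd[OF dvd_refl] by blast
    \<comment> \<open>Then \<open>\<Delta> * n k = M * h k\<close> for \<open>k \<noteq> i\<close>.\<close>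
    define n where "n k = (if k = i then 0 else c * h k)" for k
    obtain \<gamma>' where \<gamma>': "det \<gamma>' = 1"
      "\<And>k. \<gamma>' *v v' k = \<gamma> *v v' k + (\<Delta> * n k) *s (\<gamma> *v axis i 1)"
      using exists_SL_with_prescribed_displacements[where v = v' and n = n, OF v'i a0' _ \<gamma>]
      unfolding det' by (auto simp: n_def)
    have "x + \<gamma>' *v v' k \<in> E" for k
    proof (cases "k = i")
      case True
      have "\<gamma> *v v' i = ?z l" unfolding v'i int_matrix_scalar_commute \<gamma>_def p ..
      then show ?thesis using x(2) True by (simp add: \<gamma>'(2) n_def)
    next
      case False
      have "\<gamma> *v axis i 1 = p l" unfolding \<gamma>_def p ..
      then show ?thesis using h[OF False] False by (simp add: \<gamma>'(2) n_def c add.assoc mult.assoc)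
    qed
    then have "x + (\<gamma>' ** \<gamma>0) *v v k \<in> E" for k by (simp add: v'_def matrix_vector_mul_assoc)
    moreover have "\<gamma>' ** \<gamma>0 \<in> SL_int" using \<gamma>'(1) \<gamma>0(1) by (simp add: SL_int_def det_mul)
    ultimately show "\<exists>v0\<in>E. \<exists>\<gamma>\<in>SL_int. \<forall>i. v0 + \<gamma> *v v i \<in> E" using x(1) by blast
  qed
qed

section \<open>Density on boxes\<close>
lemma int_box_conv_PiE: "int_box N = vec_lambda ` (UNIV \<rightarrow>\<^sub>E {0..<int N} :: ('d::finite \<Rightarrow> int) set)"
proof (intro equalityI subsetI)
  fix x :: "int ^ 'd" assume "x \<in> int_box N"
  then have "($) x \<in> UNIV \<rightarrow>\<^sub>E {0..<int N}" by (auto simp: int_box_def)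
  then show "x \<in> vec_lambda ` (UNIV \<rightarrow>\<^sub>E {0..<int N})" by (intro image_eqI[of _ _ "($) x"]) auto
qed (force simp: int_box_def PiE_def Pi_def)

lemma finite_int_box: "finite (int_box N :: (int ^ 'd::finite) set)"
  unfolding int_box_conv_PiE by (intro finite_imageI finite_PiE) auto

lemma card_int_box: "card (int_box N :: (int ^ 'd::finite) set) = N ^ CARD('d)"
proof -
  have "inj_on vec_lambda (UNIV \<rightarrow>\<^sub>E {0..<int N} :: ('d \<Rightarrow> int) set)"
    by (auto intro!: inj_onI simp: vec_lambda_inject)
  then show ?thesis unfolding int_box_conv_PiE by (simp add: card_image card_PiE)
qed

text \<open>
  Unlike the upper Banach density, this form passes directly to a dilated copy of \<open>E\<close> and
  directly provides the boxes along which an invariant mean is built.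
\<close>
definition dense_on_boxes :: "(int ^ 'd) set \<Rightarrow> real \<Rightarrow> bool" where
  "dense_on_boxes E a \<longleftrightarrow>
     (\<forall>n. \<exists>N>n. \<exists>v. a * real N ^ CARD('d) \<le> real (card (E \<inter> (+) v ` int_box N)))"

lemma dense_on_boxes_le_one:
  fixes E :: "(int ^ 'd::finite) set"
  assumes "dense_on_boxes E a"
  shows "a \<le> 1"
proof -
  obtain N v where N: "N > 0" "a * real N ^ CARD('d) \<le> real (card (E \<inter> (+) v ` int_box N))"
    using assms unfolding dense_on_boxes_def by blast
  have "card (E \<inter> (+) v ` int_box N) \<le> card ((+) v ` int_box N)"
    by (intro card_mono) (auto simp: finite_int_box)
  also have "\<dots> = N ^ CARD('d)" by (simp add: card_image card_int_box)
  finally have "real (card (E \<inter> (+) v ` int_box N)) \<le> real N ^ CARD('d)"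
    by (metis of_nat_le_iff of_nat_power)
  then have "a * real N ^ CARD('d) \<le> 1 * real N ^ CARD('d)" using N(2) by linarith
  then show ?thesis using N(1) by (subst (asm) mult_le_cancel_right_pos) auto
qed

lemma dense_on_boxes_of_upper_banach_density:
  fixes E :: "(int ^ 'd::finite) set"
  assumes "ereal \<delta> \<le> upper_banach_density E" "a < \<delta>"
  shows "dense_on_boxes E a"
proof (rule ccontr)
  assume "\<not> ?thesis"
  then obtain n where n: "\<And>N v. N > n \<Longrightarrow> real (card (E \<inter> (+) v ` int_box N)) < a * real N ^ CARD('d)"
    by (auto simp: dense_on_boxes_def not_le)
  have "(SUP v. ereal (real (card (E \<inter> (+) v ` int_box N)) / real N ^ CARD('d))) \<le> ereal a"
    if "N > n" for N
    using n[OF that] that by (intro SUP_least) (simp add: field_simps less_imp_le)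
  then have "upper_banach_density E \<le> ereal a"
    unfolding upper_banach_density_def
    by (intro Limsup_bounded eventually_sequentiallyI[of "Suc n"]) auto
  then show False using assms by (metis ereal_less_eq(3) not_le order_trans)
qed

text \<open>
  For every \<open>L\<close> some translate of \<open>M \<cdot> [0, L)\<^sup>d\<close> contains too many points of \<open>E\<close>. There are finitely
  many cosets of \<open>M \<int>\<^sup>d\<close>, so one of them accounts for infinitely many \<open>L\<close>.
\<close>
lemma density_increment:
  fixes E :: "(int ^ 'd::finite) set" and M :: int
  assumes M: "0 < M"
    and no: "\<not> (\<exists>L>0. \<forall>x. real (card {j \<in> int_box L. x + M *s j \<in> E}) \<le> b * real L ^ CARD('d))"
  shows "\<exists>y. dense_on_boxes {x. y + M *s x \<in> E} b"
proof -
  have "\<forall>L. \<exists>x. L > 0 \<longrightarrow> b * real L ^ CARD('d) < real (card {j \<in> int_box L. x + M *s j \<in> E})"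
    using no unfolding not_ex not_all de_Morgan_conj not_le by blast
  from choice[OF this] obtain x
    where x: "\<And>L. L > 0 \<Longrightarrow> b * real L ^ CARD('d) < real (card {j \<in> int_box L. x L + M *s j \<in> E})"
    by blast
  define y where "y L = (\<chi> i. x L $ i mod M)" for L
  have "y ` {0<..} \<subseteq> int_box (nat M)" using M by (auto simp: y_def int_box_def)
  then have "finite (y ` {0<..})" using finite_int_box finite_subset by blast
  then obtain L0 where inf: "infinite {L \<in> {0<..}. y L = y L0}"
    using pigeonhole_infinite[of "{0::nat<..}" y] infinite_Ioi by blast
  have "dense_on_boxes {x. y L0 + M *s x \<in> E} b"
    unfolding dense_on_boxes_def
  proof
    fix n
    obtain L where L: "L > n" "L > 0" "y L = y L0"
      using inf by (auto simp: infinite_nat_iff_unbounded)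
    define z where "z = (\<chi> i. x L $ i div M)"
    have xL: "x L = y L0 + M *s z"
      unfolding L(3)[symmetric] by (simp add: y_def z_def vec_eq_iff)
    have "(\<lambda>j. z + j) ` {j \<in> int_box L. x L + M *s j \<in> E}
        \<subseteq> {x. y L0 + M *s x \<in> E} \<inter> (+) z ` int_box L"
      by (auto simp: xL vector_add_ldistrib add.assoc)
    then have "card ((\<lambda>j. z + j) ` {j \<in> int_box L. x L + M *s j \<in> E})
        \<le> card ({x. y L0 + M *s x \<in> E} \<inter> (+) z ` int_box L)"
      by (intro card_mono) (auto simp: finite_int_box)
    then have "card {j \<in> int_box L. x L + M *s j \<in> E}
        \<le> card ({x. y L0 + M *s x \<in> E} \<inter> (+) z ` int_box L)"
      by (simp add: card_image)
    then show "\<exists>N>n. \<exists>v. b * real N ^ CARD('d)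
        \<le> real (card ({x. y L0 + M *s x \<in> E} \<inter> (+) v ` int_box N))"
      using x[OF L(2)] L(1) by (intro exI[of _ L] conjI exI[of _ z]) auto
  qed
  then show ?thesis by blast
qed


text \<open>
  A box and its translate by \<open>y\<close> share a concentric box whose side is shorter by \<open>2 K\<close>, where \<open>K\<close>
  bounds the coordinates of \<open>y\<close>; only the rest contributes to the difference.
\<close>
lemma averages_asymptotically_invariant:
  fixes f :: "int ^ 'd::finite \<Rightarrow> real" and y :: "int ^ 'd"
  assumes f: "\<And>x. \<bar>f x\<bar> \<le> c" and N: "filterlim N at_top sequentially"
  shows "(\<lambda>n. (\<Sum>x\<in>(+) (v n) ` int_box (N n). f (x + y)) / real (N n) ^ CARD('d)
      - (\<Sum>x\<in>(+) (v n) ` int_box (N n). f x) / real (N n) ^ CARD('d)) \<longlonglongrightarrow> 0"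
proof -
  define K where "K = nat (\<Sum>i\<in>UNIV. \<bar>y $ i\<bar>)"
  have K: "\<bar>y $ i\<bar> \<le> int K" for i
    using member_le_sum[of i UNIV "\<lambda>i. \<bar>y $ i\<bar>"] by (simp add: K_def sum_nonneg)
  have c: "0 \<le> c" using f[of 0] by linarith
  let ?d = "CARD('d)"
  have bound: "\<bar>(\<Sum>x\<in>(+) w ` int_box L. f (x + y)) / real L ^ ?d - (\<Sum>x\<in>(+) w ` int_box L. f x) / real L ^ ?d\<bar>
     \<le> 2 * c * (1 - (1 - 2 * real K / real L) ^ ?d)" if L: "L > 2 * K" for w L
  proof -
    define B :: "(int ^ 'd) set" where "B = (+) w ` int_box L"
    define C :: "(int ^ 'd) set" where "C = (+) (w + (\<chi> i. int K)) ` int_box (L - 2 * K)"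
    define B' where "B' = (\<lambda>x. x + y) ` B"
    have memB: "x \<in> B \<longleftrightarrow> (\<forall>i. 0 \<le> x $ i - w $ i \<and> x $ i - w $ i \<le> int L - 1)" for x
      unfolding B_def by (auto simp: int_box_def intro!: image_eqI[of x _ "x - w"])
    have memC: "x \<in> C \<Longrightarrow> int K \<le> x $ i - w $ i \<and> x $ i - w $ i \<le> int L - 1 - int K" for x i
      unfolding C_def using L by (auto simp: int_box_def of_nat_diff dest!: spec[of _ i])
    have CB: "C \<subseteq> B"
    proof
      fix x assume x: "x \<in> C"
      show "x \<in> B" unfolding memB
      proof
        fix i
        show "0 \<le> x $ i - w $ i \<and> x $ i - w $ i \<le> int L - 1" using memC[OF x, of i] by linarith
      qed
    qed
    have CB': "C \<subseteq> B'"
    proof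
      fix x assume x: "x \<in> C"
      have "x - y \<in> B" unfolding memB
      proof
        fix i
        show "0 \<le> (x - y) $ i - w $ i \<and> (x - y) $ i - w $ i \<le> int L - 1"
          using memC[OF x, of i] K[of i] by auto
      qed
      then show "x \<in> B'" unfolding B'_def by (intro image_eqI[of x _ "x - y"]) auto
    qed
    have "real L \<noteq> 0" using L by simp
    have fin: "finite B" "finite B'" by (auto simp: B_def B'_def finite_int_box)
    have cards: "card B = L ^ ?d" "card B' = L ^ ?d" "card C = (L - 2 * K) ^ ?d"
      by (simp_all add: B_def B'_def C_def card_image card_int_box)
    have rest: "\<bar>\<Sum>x\<in>S - C. f x\<bar> \<le> c * (real L ^ ?d - real (L - 2 * K) ^ ?d)"
      if S: "C \<subseteq> S" "finite S" "card S = L ^ ?d" for S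
    proof -
      have "\<bar>\<Sum>x\<in>S - C. f x\<bar> \<le> (\<Sum>x\<in>S - C. c)"
        using f by (intro order_trans[OF sum_abs] sum_mono)
      also have "\<dots> = c * (real (card S) - real (card C))"
        using S(1) finite_subset[OF S(1,2)] card_mono[OF S(2,1)]
        by (simp add: card_Diff_subset of_nat_diff)
      finally show ?thesis by (simp add: S cards)
    qed
    have split: "(\<Sum>x\<in>S. f x) = (\<Sum>x\<in>C. f x) + (\<Sum>x\<in>S - C. f x)" if "C \<subseteq> S" "finite S" for S
      using sum.subset_diff[OF that] by (simp add: add.commute)
    have "(\<Sum>x\<in>B. f (x + y)) = (\<Sum>x\<in>B'. f x)"
      unfolding B'_def by (subst sum.reindex) auto
    then have "\<bar>(\<Sum>x\<in>B. f (x + y)) - (\<Sum>x\<in>B. f x)\<bar> \<le> 2 * (c * (real L ^ ?d - real (L - 2 * K) ^ ?d))"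
      using split[OF CB fin(1)] split[OF CB' fin(2)] rest[OF CB fin(1) cards(1)]
        rest[OF CB' fin(2) cards(2)] by linarith
    then have "\<bar>(\<Sum>x\<in>B. f (x + y)) - (\<Sum>x\<in>B. f x)\<bar> / real L ^ ?d
        \<le> 2 * (c * (real L ^ ?d - real (L - 2 * K) ^ ?d)) / real L ^ ?d"
      by (intro divide_right_mono) auto
    also have "\<dots> = 2 * c * (1 - (real (L - 2 * K) / real L) ^ ?d)"
      using \<open>real L \<noteq> 0\<close> by (simp add: power_divide diff_divide_distrib right_diff_distrib)
    also have "real (L - 2 * K) / real L = 1 - 2 * real K / real L"
      using L by (simp add: of_nat_diff diff_divide_distrib)
    finally show ?thesis using L by (simp add: B_def diff_divide_distrib[symmetric])
  qed
  have "(\<lambda>n. 2 * real K / real (N n)) \<longlonglongrightarrow> 0"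
    by (rule real_tendsto_divide_at_top[OF tendsto_const
          filterlim_compose[OF filterlim_real_sequentially N]])
  then have "(\<lambda>n. 2 * c * (1 - (1 - 2 * real K / real (N n)) ^ ?d)) \<longlonglongrightarrow> 2 * c * (1 - (1 - 0) ^ ?d)"
    by (intro tendsto_intros)
  then have lim: "(\<lambda>n. 2 * c * (1 - (1 - 2 * real K / real (N n)) ^ ?d)) \<longlonglongrightarrow> 0" by simp
  have "eventually (\<lambda>n. N n > 2 * K) sequentially"
    using N[unfolded filterlim_at_top, rule_format, of "Suc (2 * K)"] by (simp add: Suc_le_eq)
  then show ?thesis
    by (intro tendsto_0_le[OF lim, of _ 1]) (auto elim!: eventually_mono intro!: order_trans[OF bound])
qed

text \<open>
  The averages over the boxes are points of a product of compact intervals, one for each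
  function. By Tychonoff's theorem they have a cluster point \<open>m\<close>, and the defining identities
  of a mean are inherited along a filter \<open>F\<close> that refines the sequence and converges to \<open>m\<close>.
\<close>
lemma exists_invariant_mean:
  fixes E :: "(int ^ 'd::finite) set"
  assumes "dense_on_boxes E a"
  shows "\<exists>m. invariant_mean m \<and> a \<le> m (indicator E)"
proof -
  obtain N v where N: "\<And>n. N n > n"
    and dens: "\<And>n. a * real (N n) ^ CARD('d) \<le> real (card (E \<inter> (+) (v n) ` int_box (N n)))"
    using assms unfolding dense_on_boxes_def by metis
  have Ntop: "filterlim N at_top sequentially"
    by (rule filterlim_at_top_mono[OF filterlim_ident]) (simp add: N less_imp_le)
  define X where "X n f = (if bounded_fun f
      then (\<Sum>x\<in>(+) (v n) ` int_box (N n). f x) / real (N n) ^ CARD('d) else 0)"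
    for n and f :: "int ^ 'd \<Rightarrow> real"
  have pos: "0 < real (N n) ^ CARD('d)" for n using N[of n] by simp
  have X_le: "X n f \<le> c" if "bounded_fun f" "\<And>x. f x \<le> c" for n f c
  proof -
    have "(\<Sum>x\<in>(+) (v n) ` int_box (N n). f x) \<le> (\<Sum>x\<in>(+) (v n) ` int_box (N n). c)"
      using that by (intro sum_mono)
    also have "\<dots> = real (N n) ^ CARD('d) * c" by (simp add: card_image card_int_box)
    finally show ?thesis using that pos[of n] by (simp add: X_def field_simps)
  qed
  have X_add: "X n (\<lambda>x. f x + g x) = X n f + X n g" if "bounded_fun f" "bounded_fun g" for n f g
    using that by (simp add: X_def sum.distrib add_divide_distrib)
  have X_scale: "X n (\<lambda>x. c * f x) = c * X n f" if "bounded_fun f" for n f c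
    using that by (simp add: X_def sum_distrib_left)
  \<comment> \<open>The value \<open>0\<close> on unbounded functions keeps every coordinate of \<open>X\<close> bounded.\<close>
  have "\<exists>c. \<forall>n. \<bar>X n f\<bar> \<le> c" for f
  proof (cases "bounded_fun f")
    case True
    then obtain c where c: "\<And>x. \<bar>f x\<bar> \<le> c" by (auto simp: bounded_fun_def)
    have "X n f \<le> c" for n using X_le[OF True] c abs_le_D1 by blast
    moreover have "- X n f \<le> c" for n
      using X_le[of "\<lambda>x. -1 * f x" c n] X_scale[OF True, of n "-1"] True c abs_le_D2 by auto
    ultimately show ?thesis by (auto simp: abs_le_iff)
  qed (auto simp: X_def)
  then obtain c where c: "\<And>n f. \<bar>X n f\<bar> \<le> c f" by metis
  define P where "P = PiE UNIV (\<lambda>f. {- c f..c f})"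
  have "compactin (product_topology (\<lambda>_. euclidean) UNIV) P"
    unfolding P_def compactin_PiE by simp
  then have "compact P" by (simp add: euclidean_product_topology)
  moreover have "X n \<in> P" for n using c[of n] by (auto simp: P_def abs_le_iff minus_le_iff)
  then have "eventually (\<lambda>\<phi>. \<phi> \<in> P) (filtermap X sequentially)" by (simp add: eventually_filtermap)
  moreover have "filtermap X sequentially \<noteq> bot" by (simp add: filtermap_bot_iff)
  ultimately obtain m where m: "inf (nhds m) (filtermap X sequentially) \<noteq> bot"
    unfolding compact_filter by blast
  define F where "F = inf (nhds m) (filtermap X sequentially)"
  have F: "F \<noteq> bot" using m by (simp add: F_def)
  have ev: "eventually p F" if "\<And>n. p (X n)" for p
  proof (rule filter_leD)
    show "F \<le> filtermap X sequentially" by (simp add: F_def)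
  qed (simp add: eventually_filtermap that)
  have coord: "((\<lambda>\<phi>. \<phi> f) \<longlongrightarrow> m f) F" for f
  proof -
    have "((\<lambda>\<phi>. \<phi> f) \<longlongrightarrow> m f) (at m)"
      using continuous_on_product_coordinates[of f] unfolding continuous_on_def by blast
    then have "((\<lambda>\<phi>. \<phi> f) \<longlongrightarrow> m f) (nhds m)" 
      using tendsto_at_iff_tendsto_nhds[of "\<lambda>\<phi>. \<phi> f" m] by blast
    then show ?thesis by (rule tendsto_mono[rotated]) (simp add: F_def)
  qed
  have lim_eq: "a = b" if "((\<lambda>\<phi>. p \<phi>) \<longlongrightarrow> a) F" "((\<lambda>\<phi>. q \<phi>) \<longlongrightarrow> b) F" "\<And>n. p (X n) = q (X n)"
    for p q and a b :: real
  proof -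
    have "((\<lambda>\<phi>. q \<phi>) \<longlongrightarrow> a) F"
      using tendsto_cong[OF ev[of "\<lambda>\<phi>. p \<phi> = q \<phi>"]] that by blast
    then show ?thesis using tendsto_unique[OF F] that(2) by blast
  qed
  have lower: "b \<le> m f" if "\<And>n. b \<le> X n f" for b f
    by (rule tendsto_lowerbound[OF coord ev F]) (rule that)
  have one: "X n (\<lambda>x. 1) = 1" for n
    using pos[of n] by (simp add: X_def card_image card_int_box)
  have "invariant_mean m"
  proof
    show "m (\<lambda>x. f x + g x) = m f + m g" if "bounded_fun f" "bounded_fun g" for f g
      by (rule lim_eq[OF coord tendsto_add[OF coord coord]]) (rule X_add[OF that])
    show "m (\<lambda>x. b * f x) = b * m f" if "bounded_fun f" for f b
      by (rule lim_eq[OF coord tendsto_mult[OF tendsto_const coord]]) (rule X_scale[OF that])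
    show "0 \<le> m f" if "bounded_fun f" "\<And>x. 0 \<le> f x" for f
      by (rule lower) (use that pos in \<open>auto simp: X_def intro!: divide_nonneg_pos sum_nonneg\<close>)
    show "m (\<lambda>x. 1) = 1" by (rule lim_eq[OF coord tendsto_const]) (rule one)
    show "m (\<lambda>x. f (x + y)) = m f" if f: "bounded_fun f" for f y
    proof -
      obtain c where c: "\<And>x. \<bar>f x\<bar> \<le> c" using f by (auto simp: bounded_fun_def)
      have "(\<lambda>n. X n (\<lambda>x. f (x + y)) - X n f) \<longlonglongrightarrow> 0"
        using averages_asymptotically_invariant[where f = f and v = v and y = y, OF c Ntop] f by (simp add: X_def bounded_fun_shift)
      then have "((\<lambda>\<phi>. \<phi> (\<lambda>x. f (x + y)) - \<phi> f) \<longlongrightarrow> 0) (filtermap X sequentially)"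
        by (simp add: tendsto_compose_filtermap comp_def filterlim_filtermap)
      then have "((\<lambda>\<phi>. \<phi> (\<lambda>x. f (x + y)) - \<phi> f) \<longlongrightarrow> 0) F"
        by (rule tendsto_mono[rotated]) (simp add: F_def)
      from tendsto_unique[OF F this tendsto_diff[OF coord coord]] show ?thesis by simp
    qed
  qed
  moreover have "a \<le> m (indicator E)"
  proof (rule lower)
    fix n
    have "(\<Sum>x\<in>(+) (v n) ` int_box (N n). indicator E x) = real (card (E \<inter> (+) (v n) ` int_box (N n)))"
      by (simp add: indicator_def of_bool_def sum.inter_filter[symmetric] finite_int_box
          Int_def conj_commute)
    then show "a \<le> X n (indicator E)"
      using dens[of n] pos[of n] by (simp add: X_def pos_le_divide_eq)
  qed
  ultimately show ?thesis by blast
qed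


lemma regular_set_minsq_le:
  fixes E :: "(int ^ 'd::finite) set" and m :: "(int ^ 'd \<Rightarrow> real) \<Rightarrow> real"
  assumes m: "invariant_mean m" and L: "0 < L"
    and le: "\<And>x. real (card {j \<in> int_box L. x + M *s j \<in> E}) \<le> (m (indicator E) + \<eta>) * real L ^ CARD('d)"
    and \<eta>: "0 \<le> \<eta>"
  shows "invariant_mean.minsq m (sublattice (mat 1) UNIV M) (\<lambda>x. indicator E x - m (indicator E)) \<le> 2 * \<eta>"
proof -
  interpret invariant_mean m by (rule m)
  let ?J = "int_box L :: (int ^ 'd) set"
  have card: "card ?J = L ^ CARD('d)" by (rule card_int_box)
  then have ne: "?J \<noteq> {}" using L by auto
  have "M *s j \<in> sublattice (mat 1) UNIV M" for j :: "int ^ 'd"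
    unfolding sublattice_def by (intro CollectI exI[of _ "M *s j"]) auto
  then have "(\<lambda>f x. (\<Sum>j\<in>?J. f (x + M *s j)) / real (card ?J)) \<in> averaging (sublattice (mat 1) UNIV M)"
    by (intro averaging_mean finite_int_box ne)
  then show ?thesis
  proof (rule minsq_le_of_upper_bound[OF _ _ \<eta>])
    fix x
    have "(\<Sum>j\<in>?J. indicator E (x + M *s j)) = real (card {j \<in> ?J. x + M *s j \<in> E})"
      by (simp add: indicator_def of_bool_def sum.inter_filter[symmetric] finite_int_box)
    then show "(\<Sum>j\<in>?J. indicator E (x + M *s j)) / real (card ?J) \<le> m (indicator E) + \<eta>"
      using le[of x] L by (simp add: card pos_divide_le_eq)
  qed
qed

section \<open>Iterating the density increment\<close>
definition contains_dilates :: "nat \<Rightarrow> (int ^ 'd::finite) set \<Rightarrow> nat \<Rightarrow> bool" where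
  "contains_dilates D E k \<longleftrightarrow> (\<forall>v :: 'd \<Rightarrow> int ^ 'd.
     0 < \<bar>det (matrix_of_columns v)\<bar> \<and> \<bar>det (matrix_of_columns v)\<bar> \<le> int D \<longrightarrow>
     (\<exists>v0\<in>E. \<exists>\<gamma>\<in>SL_int. \<forall>i. v0 + int k *s (\<gamma> *v v i) \<in> E))"

lemma contains_dilates_scale:
  assumes "contains_dilates D {x. y + int M *s x \<in> E} k"
  shows "contains_dilates D E (M * k)"
  unfolding contains_dilates_def
proof (intro allI impI)
  fix v :: "'a \<Rightarrow> int ^ 'a"
  assume "0 < \<bar>det (matrix_of_columns v)\<bar> \<and> \<bar>det (matrix_of_columns v)\<bar> \<le> int D"
  then obtain x \<gamma> where x: "y + int M *s x \<in> E" "\<gamma> \<in> SL_int"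
      "\<And>i. y + int M *s (x + int k *s (\<gamma> *v v i)) \<in> E"
    using assms unfolding contains_dilates_def by auto
  have "y + int M *s (x + int k *s z) = (y + int M *s x) + int (M * k) *s z" for z
    by (simp add: vec_eq_iff algebra_simps)
  then show "\<exists>v0\<in>E. \<exists>\<gamma>\<in>SL_int. \<forall>i. v0 + int (M * k) *s (\<gamma> *v v i) \<in> E"
    using x by metis
qed

theorem corollary1p3:
  fixes D :: nat and \<delta> :: real
  assumes "CARD('d::finite) \<ge> 2" and "D > 0" and "\<delta> > 0"
  shows "\<exists>k0::nat. k0 > 0 \<and>
    (\<forall>E :: (int ^ 'd) set. upper_banach_density E \<ge> ereal \<delta> \<longrightarrow>
      (\<exists>k::nat. 1 \<le> k \<and> k \<le> k0 \<and>
        (\<forall>v :: 'd \<Rightarrow> int ^ 'd.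
          0 < \<bar>det (matrix_of_columns v)\<bar> \<and> \<bar>det (matrix_of_columns v)\<bar> \<le> int D \<longrightarrow>
          (\<exists>v0 \<in> E. \<exists>\<gamma> \<in> SL_int. \<forall>i. v0 + int k *s (\<gamma> *v v i) \<in> E))))"
proof -
  obtain M :: int and \<epsilon> where M: "0 < M" and \<epsilon>: "0 < \<epsilon>"
    and simplices: "\<And>(m :: (int ^ 'd \<Rightarrow> real) \<Rightarrow> real) E. invariant_mean m \<Longrightarrow>
      \<delta> / 2 \<le> m (indicator E) \<Longrightarrow>
      invariant_mean.minsq m (sublattice (mat 1) UNIV M) (\<lambda>x. indicator E x - m (indicator E)) < \<epsilon> \<Longrightarrow>
      contains_dilates D E 1"
    using regular_set_contains_simplices[OF assms(1,2), of "\<delta> / 2"] assms(3)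
    unfolding contains_dilates_def by auto
  define K where "K = nat M"
  have K: "0 < K" "M = int K" using M by (auto simp: K_def)
  define \<eta> where "\<eta> = \<epsilon> / 3"
  have \<eta>: "0 < \<eta>" using \<epsilon> by (simp add: \<eta>_def)
  \<comment> \<open>At most \<open>n\<close> increments are possible from density \<open>a\<close>, and each one contributes a factor \<open>K\<close>.\<close>
  have iterate: "\<exists>k\<in>{1..K ^ n}. contains_dilates D E k"
    if "dense_on_boxes E a" "\<delta> / 2 \<le> a" "1 < a + real n * \<eta>" for n a and E :: "(int ^ 'd) set"
    using that
  proof (induction n arbitrary: a E)
    case 0
    then show ?case using dense_on_boxes_le_one[OF 0(1)] by simp
  next
    case (Suc n)
    have pow: "1 \<le> K ^ Suc n" using K(1) by (simp add: Suc_le_eq)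
    show ?case
    proof (cases "\<exists>L>0. \<forall>x. real (card {j \<in> int_box L. x + M *s j \<in> E}) \<le> (a + \<eta>) * real L ^ CARD('d)")
      case True
      then obtain L where L: "0 < L"
        "\<And>x. real (card {j \<in> int_box L. x + M *s j \<in> E}) \<le> (a + \<eta>) * real L ^ CARD('d)" by blast
      obtain m where m: "invariant_mean m" "a \<le> m (indicator E)"
        using exists_invariant_mean[OF Suc.prems(1)] by blast
      have "real (card {j \<in> int_box L. x + M *s j \<in> E}) \<le> (m (indicator E) + \<eta>) * real L ^ CARD('d)" for x
        using m(2) by (intro order_trans[OF L(2)] mult_right_mono) auto
      from regular_set_minsq_le[OF m(1) L(1) this less_imp_le[OF \<eta>]]
      have "contains_dilates D E 1"
        using m Suc.prems(2) \<epsilon> by (intro simplices[OF m(1)]) (auto simp: \<eta>_def)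
      then show ?thesis using pow by auto
    next
      case False
      obtain y where "dense_on_boxes {x. y + M *s x \<in> E} (a + \<eta>)"
        using density_increment[OF M False] by blast
      moreover have "1 < (a + \<eta>) + real n * \<eta>" using Suc.prems(3) by (simp add: algebra_simps)
      ultimately obtain k where k: "k \<in> {1..K ^ n}" "contains_dilates D {x. y + M *s x \<in> E} k"
        using Suc.IH[of "{x. y + M *s x \<in> E}" "a + \<eta>"] Suc.prems(2) \<eta> by auto
      then have "contains_dilates D E (K * k)" unfolding K(2) by (intro contains_dilates_scale)
      moreover have "K * k \<in> {1..K ^ Suc n}" using k(1) K(1) by (auto simp: Suc_le_eq)
      ultimately show ?thesis by blast
    qed
  qed
  obtain n where n: "1 < real n * \<eta>" using reals_Archimedean3[OF \<eta>] by blast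
  show ?thesis
  proof (rule exI[of _ "K ^ n"], intro conjI allI impI)
    show "0 < K ^ n" using K(1) by simp
    fix E :: "(int ^ 'd) set" assume "ereal \<delta> \<le> upper_banach_density E"
    then have "dense_on_boxes E (\<delta> / 2)"
      using assms(3) by (intro dense_on_boxes_of_upper_banach_density[of \<delta>]) auto
    moreover have "1 < \<delta> / 2 + real n * \<eta>" using n assms(3) by linarith
    ultimately obtain k where "k \<in> {1..K ^ n}" "contains_dilates D E k"
      using iterate[OF _ order_refl] by blast
    then show "\<exists>k::nat. 1 \<le> k \<and> k \<le> K ^ n \<and>
        (\<forall>v :: 'd \<Rightarrow> int ^ 'd.
          0 < \<bar>det (matrix_of_columns v)\<bar> \<and> \<bar>det (matrix_of_columns v)\<bar> \<le> int D \<longrightarrow>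
          (\<exists>v0 \<in> E. \<exists>\<gamma> \<in> SL_int. \<forall>i. v0 + int k *s (\<gamma> *v v i) \<in> E))"
      unfolding contains_dilates_def by auto
  qed
qed

end
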